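(* Let $K\subset\mathbb R^2$ be a triangle with vertices $\mathbf P_1,\mathbf P_2,\mathbf P_3$, let $e$ be the edge $\mathbf P_1\mathbf P_2$, let $h_K$ be the length of the longest edge of $K$, and let $H_K=2|K|/|e|$ be the height of $K$ with respect to $e$. Then for every $u\in H^1(K)$, $$\|u-\Pi_hu\|_{0,e}\le 0.6711\,\frac{h_K}{\sqrt{H_K}}\,|u-\Pi_hu|_{1,K}.$$
   Context: $\Pi_h u$ denotes the Crouzeix--Raviart interpolation of $u$ on $K$: the unique linear polynomial on $K$ satisfying $\int_{e_i}\Pi_hu\,\mathrm ds=\int_{e_i}u\,\mathrm ds$ for each of the three edges $e_1,e_2,e_3$ of $K$ (traces understood in the $L^2$ sense). $\|\cdot\|_{0,e}$ is the $L^2(e)$ norm, $|\cdot|_{1,K}=\|\nabla\cdot\|_{L^2(K)}$ is the $H^1$ seminorm on $K$, and $|K|$, $|e|$ denote the area of $K$ and the length of $e$. *)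

theory Defs
  imports "HOL-Analysis.Analysis"
begin

definition C1_grad :: "(real^2 \<Rightarrow> real) \<Rightarrow> (real^2 \<Rightarrow> real^2) \<Rightarrow> bool" where
  "C1_grad f G \<longleftrightarrow> continuous_on UNIV G \<and> (\<forall>x. (f has_derivative (\<lambda>h. G x \<bullet> h)) (at x))"

definition L2_on :: "(real^2) set \<Rightarrow> (real^2 \<Rightarrow> real) \<Rightarrow> bool" where
  "L2_on K u \<longleftrightarrow> u \<in> borel_measurable (lebesgue_on K) \<and> integrable (lebesgue_on K) (\<lambda>x. (u x)\<^sup>2)"

definition L2v_on :: "(real^2) set \<Rightarrow> (real^2 \<Rightarrow> real^2) \<Rightarrow> bool" where
  "L2v_on K g \<longleftrightarrow> g \<in> borel_measurable (lebesgue_on K) \<and> integrable (lebesgue_on K) (\<lambda>x. (norm (g x))\<^sup>2)"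

definition weak_grad :: "(real^2) set \<Rightarrow> (real^2 \<Rightarrow> real) \<Rightarrow> (real^2 \<Rightarrow> real^2) \<Rightarrow> bool" where
  "weak_grad K u g \<longleftrightarrow>
     (\<forall>\<phi> D\<phi>. C1_grad \<phi> D\<phi> \<and> compact (closure {x. \<phi> x \<noteq> 0}) \<and> closure {x. \<phi> x \<noteq> 0} \<subseteq> interior K \<longrightarrow>
        (\<forall>i. integral\<^sup>L (lebesgue_on K) (\<lambda>x. u x * D\<phi> x $ i)
             = - integral\<^sup>L (lebesgue_on K) (\<lambda>x. g x $ i * \<phi> x)))"

definition H1_on :: "(real^2) set \<Rightarrow> (real^2 \<Rightarrow> real) \<Rightarrow> (real^2 \<Rightarrow> real^2) \<Rightarrow> bool" where
  "H1_on K u g \<longleftrightarrow> L2_on K u \<and> L2v_on K g \<and> weak_grad K u g"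

text \<open>Affine parametrisation of the segment from A to B by t in [0,1]; arc length ds = |AB| dt.\<close>
definition seg_param :: "real^2 \<Rightarrow> real^2 \<Rightarrow> real \<Rightarrow> real^2" where
  "seg_param A B t = A + t *\<^sub>R (B - A)"

definition edge_int :: "real^2 \<Rightarrow> real^2 \<Rightarrow> (real \<Rightarrow> real) \<Rightarrow> real" where
  "edge_int A B f = dist A B * integral\<^sup>L (lebesgue_on {0..1}) f"

text \<open>L^2 trace of (u, with weak gradient g) in H^1(K) on the edge AB, expressed as a function
  of the parameter t in [0,1] (i.e. tr t is the trace value at seg_param A B t).
  The trace is the L^2(e)-limit of the restrictions of smooth approximants converging in H^1(K)
  (well-defined by the trace theorem and density of smooth functions in H^1(K)).\<close>
definition is_trace :: "(real^2) set \<Rightarrow> (real^2 \<Rightarrow> real) \<Rightarrow> (real^2 \<Rightarrow> real^2)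
    \<Rightarrow> real^2 \<Rightarrow> real^2 \<Rightarrow> (real \<Rightarrow> real) \<Rightarrow> bool" where
  "is_trace K u g A B tr \<longleftrightarrow>
     tr \<in> borel_measurable (lebesgue_on {0..1}) \<and>
     integrable (lebesgue_on {0..1}) (\<lambda>t. (tr t)\<^sup>2) \<and>
     (\<exists>v G. (\<forall>n. C1_grad (v n) (G n)) \<and>
        (\<lambda>n. integral\<^sup>L (lebesgue_on K) (\<lambda>x. (v n x - u x)\<^sup>2)) \<longlonglongrightarrow> 0 \<and>
        (\<lambda>n. integral\<^sup>L (lebesgue_on K) (\<lambda>x. (norm (G n x - g x))\<^sup>2)) \<longlonglongrightarrow> 0 \<and>
        (\<lambda>n. integral\<^sup>L (lebesgue_on {0..1}) (\<lambda>t. (v n (seg_param A B t) - tr t)\<^sup>2)) \<longlonglongrightarrow> 0)"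

end

theory Submission
  imports Defs
begin

text \<open>
  Pull everything back to the reference triangle \<open>0 \<le> x \<le> y \<le> 1\<close>, the edge \<open>P1 P2\<close> becoming the
  diagonal. Three numbers of modulus at most \<open>c\<close> with sum zero have squares summing up to at most
  \<open>2 c\<^sup>2\<close>; applied to the derivatives along the three edge vectors, this bounds the energy
  \<open>\<integral> W\<^sub>x\<^sup>2 + W\<^sub>y\<^sup>2 + (W\<^sub>x + W\<^sub>y)\<^sup>2\<close> by \<open>2 h\<^sub>K\<^sup>2\<close> times the Dirichlet energy. So it suffices to show
  \<open>\<integral> W(t,t)\<^sup>2 dt \<le> \<Gamma> E(W)\<close> with \<open>\<Gamma> = 2/9\<close> for \<open>C\<^sup>1\<close> functions whose three edge means vanish,
  because \<open>2 \<cdot> 2/9 < 0.6711\<^sup>2\<close>.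

  This inequality improves itself. Cut the triangle into four similar ones and split \<open>W\<close> on each into
  its Crouzeix--Raviart interpolant and a remainder. The energy splits orthogonally; the interpolants
  are governed by an explicit quadratic form in six variables; the remainders satisfy the inequality
  with the old constant on triangles of half the size. If the inequality holds with \<open>\<Gamma>\<close>, it
  therefore holds with \<open>max (2/9) (2\<Gamma>/3)\<close>. Joining the points \<open>x\<close> and \<open>y\<close> of the edge through
  \<open>(x,y)\<close> gives the initial value \<open>\<Gamma> = 2\<close>.

  For \<open>u\<close> in \<open>H\<^sup>1\<close> one passes to the limit along the \<open>C\<^sup>1\<close> functions approximating the trace on
  \<open>P1 P2\<close>. Their means over the other two edges converge as well, since edge means are continuous in
  the \<open>H\<^sup>1\<close> norm, and the slack between \<open>4/9\<close> and \<open>0.6711\<^sup>2\<close> absorbs the cross terms.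
\<close>

section \<open>Integration over the reference triangle\<close>

lemma vec2_eq_iff: "(p :: real^2) = q \<longleftrightarrow> p $ 1 = q $ 1 \<and> p $ 2 = q $ 2"
  by (simp add: vec_eq_iff forall_2)

lemma inner_vec2: "(p :: real^2) \<bullet> q = p $ 1 * q $ 1 + p $ 2 * q $ 2"
  by (simp add: inner_vec_def sum_2)

lemma vector2_conv_scaleR: "(vector [x, y] :: real^2) = x *\<^sub>R axis 1 1 + y *\<^sub>R axis 2 1"
  by (simp add: vec2_eq_iff axis_def)

lemma continuous_on_vector2 [continuous_intros]:
  assumes "continuous_on S f" "continuous_on S g"
  shows "continuous_on S (\<lambda>t. vector [f t, g t] :: real^2)"
  unfolding vector2_conv_scaleR by (intro continuous_intros assms)

lemma vector2_measurable: "(\<lambda>p. vector [fst p, snd p] :: real^2) \<in> borel_measurable borel"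
  by (intro borel_measurable_continuous_onI continuous_intros)

text \<open>Both measures give every box the product of its side lengths. The identification makes
  Fubini's theorem for pairs available on \<open>real^2\<close>.\<close>

lemma lborel_vec2: "(lborel :: (real^2) measure) = distr lborel borel (\<lambda>p. vector [fst p, snd p])"
proof (rule lborel_eqI)
  fix l u :: "real^2" assume le: "\<And>b. b \<in> Basis \<Longrightarrow> l \<bullet> b \<le> u \<bullet> b"
  have le1: "l $ 1 \<le> u $ 1" "l $ 2 \<le> u $ 2"
    using le[of "axis 1 1"] le[of "axis 2 1"] by (auto simp: inner_axis axis_in_Basis_iff)
  have vim: "(\<lambda>p. vector [fst p, snd p] :: real^2) -` box l u = box (l $ 1, l $ 2) (u $ 1, u $ 2)"
    by (auto simp: mem_box_cart forall_2 box_prod)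
  have B: "(Basis :: (real^2) set) = {axis 1 1, axis 2 1}"
    by (auto simp: Basis_vec_def UNIV_2)
  have ne: "(axis 1 1 :: real^2) \<noteq> axis 2 1"
    by (simp add: axis_eq_axis)
  show "emeasure (distr lborel borel (\<lambda>p. vector [fst p, snd p])) (box l u)
      = ennreal (\<Prod>b\<in>Basis. (u - l) \<bullet> b)"
    using vector2_measurable le1
    by (subst emeasure_distr)
      (auto simp: vim emeasure_lborel_box_eq Basis_prod_def B ne inner_axis ennreal_mult mult.commute)
qed simp

text \<open>The vertices are \<open>(0,0)\<close>, \<open>(1,1)\<close> and \<open>(0,1)\<close>.
  From any point \<open>(x,y)\<close>, axis-parallel segments inside the triangle lead to the
  diagonal points \<open>(x,x)\<close> and \<open>(y,y)\<close>, which suits slicing in either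
  variable.\<close>

definition ref_tri :: "(real^2) set" where
  "ref_tri = {z. 0 \<le> z $ 1 \<and> z $ 1 \<le> z $ 2 \<and> z $ 2 \<le> 1}"

abbreviation ref_int :: "(real^2 \<Rightarrow> real) \<Rightarrow> real" where
  "ref_int F \<equiv> integral\<^sup>L (lebesgue_on ref_tri) F"

abbreviation unit_int :: "(real \<Rightarrow> real) \<Rightarrow> real" where
  "unit_int f \<equiv> integral\<^sup>L (lebesgue_on {0..1}) f"

lemma closed_ref_tri: "closed ref_tri"
proof -
  have "ref_tri = {z. 0 \<le> z $ 1} \<inter> {z. z $ 1 \<le> z $ 2} \<inter> {z. z $ 2 \<le> 1}"
    by (auto simp: ref_tri_def)
  also have "closed \<dots>"
    by (intro closed_Int closed_Collect_le continuous_intros)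
  finally show ?thesis .
qed

lemma compact_ref_tri: "compact ref_tri"
proof -
  have "ref_tri \<subseteq> cbox 0 1"
    by (auto simp: ref_tri_def mem_box_cart forall_2)
  then have "bounded ref_tri"
    using bounded_subset bounded_cbox by blast
  with closed_ref_tri show ?thesis
    by (simp add: compact_eq_bounded_closed)
qed

lemma ref_tri_measurable [measurable]: "ref_tri \<in> sets borel" "ref_tri \<in> sets lebesgue"
  using closed_ref_tri by (auto intro: borel_closed lebesgue_closedin)

lemma integrable_lebesgue_on_compact:
  fixes F :: "'a::euclidean_space \<Rightarrow> real"
  assumes "compact S" "continuous_on S F"
  shows "integrable (lebesgue_on S) F"
proof -
  have "integrable lebesgue (\<lambda>z. indicator S z *\<^sub>R F z)"
    using borel_integrable_compact[OF assms]
    by (subst integrable_completion) (auto simp: borel_measurable_integrable)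
  then show ?thesis
    using assms(1) by (subst integrable_restrict_space) (auto simp: compact_imp_closed)
qed

lemma integrable_ref_tri: "continuous_on UNIV F \<Longrightarrow> integrable (lebesgue_on ref_tri) (F :: real^2 \<Rightarrow> real)"
  by (rule integrable_lebesgue_on_compact[OF compact_ref_tri]) (rule continuous_on_subset, auto)

lemma integrable_unit: "continuous_on {0..1} f \<Longrightarrow> integrable (lebesgue_on {0..1}) (f :: real \<Rightarrow> real)"
  by (rule integrable_lebesgue_on_compact) auto

lemma integral_lebesgue_on_lborel:
  fixes F :: "'a::euclidean_space \<Rightarrow> real"
  assumes "compact S" "continuous_on S F"
  shows "integral\<^sup>L (lebesgue_on S) F = (\<integral>z. indicator S z * F z \<partial>lborel)"
proof -
  have [measurable]: "S \<in> sets borel" using assms(1) by (rule borel_compact)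
  have m: "(\<lambda>z. indicator S z *\<^sub>R F z) \<in> borel_measurable borel"
    using borel_integrable_compact[OF assms] by (simp add: borel_measurable_integrable)
  have "integral\<^sup>L (lebesgue_on S) F = (\<integral>z. indicator S z *\<^sub>R F z \<partial>lebesgue)"
    by (subst integral_restrict_space) auto
  also have "\<dots> = (\<integral>z. indicator S z *\<^sub>R F z \<partial>lborel)"
    by (rule integral_completion) (use m in simp)
  finally show ?thesis by simp
qed

text \<open>Fubini in both orders of integration. Integrability of the slice integrals is recorded
  because later estimates compare slices pointwise and then integrate.\<close>

lemma
  fixes F :: "real^2 \<Rightarrow> real"
  assumes F: "continuous_on UNIV F"
  shows ref_int_xy: "ref_int F = unit_int (\<lambda>y. integral\<^sup>L (lebesgue_on {0..y}) (\<lambda>x. F (vector [x, y])))"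
    and ref_int_yx: "ref_int F = unit_int (\<lambda>x. integral\<^sup>L (lebesgue_on {x..1}) (\<lambda>y. F (vector [x, y])))"
    and integrable_xy: "integrable (lebesgue_on {0..1}) (\<lambda>y. integral\<^sup>L (lebesgue_on {0..y}) (\<lambda>x. F (vector [x, y])))"
    and integrable_yx: "integrable (lebesgue_on {0..1}) (\<lambda>x. integral\<^sup>L (lebesgue_on {x..1}) (\<lambda>y. F (vector [x, y])))"
proof -
  \<comment> \<open>Extension by zero to the whole plane, so that the variable limits of integration
    come from the indicator function.\<close>
  define f where "f = (\<lambda>p::real\<times>real. indicator ref_tri (vector [fst p, snd p] :: real^2) * F (vector [fst p, snd p]))"
  have "integrable lborel (\<lambda>z. indicator ref_tri z * F z)"
    using borel_integrable_compact[OF compact_ref_tri continuous_on_subset[OF F]] by simp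
  then have i: "integrable lborel f"
    unfolding f_def by (subst (asm) lborel_vec2, subst (asm) integrable_distr_eq)
      (use vector2_measurable in auto)
  then have i': "integrable (lborel \<Otimes>\<^sub>M lborel) f"
    by (simp add: lborel_prod)
  have "(\<lambda>z. indicator ref_tri z * F z) \<in> borel_measurable borel"
    using borel_integrable_compact[OF compact_ref_tri continuous_on_subset[OF F]]
    by (simp add: borel_measurable_integrable)
  then have "ref_int F = integral\<^sup>L lborel f"
    unfolding f_def by (subst integral_lebesgue_on_lborel[OF compact_ref_tri continuous_on_subset[OF F]], simp,
        subst lborel_vec2, subst integral_distr) (use vector2_measurable in auto)
  then have tf: "ref_int F = integral\<^sup>L (lborel \<Otimes>\<^sub>M lborel) f"
    by (simp add: lborel_prod)
  have cx: "continuous_on S (\<lambda>x. F (vector [x, y]))" "continuous_on S (\<lambda>x. F (vector [y, x]))" for S y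
    by (auto intro!: continuous_on_compose2[OF F] continuous_intros)
  have inner_x: "(\<integral>x. f (x, y) \<partial>lborel) = indicator {0..1} y *
      integral\<^sup>L (lebesgue_on {0..y}) (\<lambda>x. F (vector [x, y]))" for y
  proof -
    have "f (x, y) = indicator {0..1} y * (indicator {0..y} x * F (vector [x, y]))" for x
      by (auto simp: f_def ref_tri_def indicator_def)
    then show ?thesis
      by (subst integral_lebesgue_on_lborel[OF _ cx(1)]) auto
  qed
  have inner_y: "(\<integral>y. f (x, y) \<partial>lborel) = indicator {0..1} x *
      integral\<^sup>L (lebesgue_on {x..1}) (\<lambda>y. F (vector [x, y]))" for x
  proof -
    have "f (x, y) = indicator {0..1} x * (indicator {x..1} y * F (vector [x, y]))" for y
      by (auto simp: f_def ref_tri_def indicator_def)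
    then show ?thesis
      by (subst integral_lebesgue_on_lborel[OF _ cx(2)]) auto
  qed
  have conv: "integrable (lebesgue_on {0..1}) g" "unit_int g = (\<integral>y. indicator {0..1} y * g y \<partial>lborel)"
    if "integrable lborel (\<lambda>y. indicator {0..1::real} y * g y)" for g :: "real \<Rightarrow> real"
  proof -
    have "integrable lebesgue (\<lambda>y. indicator {0..1::real} y * g y)"
      using that by (simp add: integrable_completion borel_measurable_integrable)
    then show "integrable (lebesgue_on {0..1}) g"
      by (subst integrable_restrict_space) auto
    show "unit_int g = (\<integral>y. indicator {0..1} y * g y \<partial>lborel)"
      using borel_measurable_integrable[OF that]
      by (subst integral_restrict_space) (auto simp: integral_completion)
  qed
  have ix: "integrable lborel (\<lambda>y. \<integral>x. f (x, y) \<partial>lborel)"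
    using lborel_pair.integrable_snd[of "\<lambda>x y. f (x, y)"] i' by simp
  have iy: "integrable lborel (\<lambda>x. \<integral>y. f (x, y) \<partial>lborel)"
    using lborel_pair.integrable_fst[of "\<lambda>x y. f (x, y)"] i' by simp
  show "integrable (lebesgue_on {0..1}) (\<lambda>y. integral\<^sup>L (lebesgue_on {0..y}) (\<lambda>x. F (vector [x, y])))"
    using ix unfolding inner_x by (rule conv)
  show "integrable (lebesgue_on {0..1}) (\<lambda>x. integral\<^sup>L (lebesgue_on {x..1}) (\<lambda>y. F (vector [x, y])))"
    using iy unfolding inner_y by (rule conv)
  show "ref_int F = unit_int (\<lambda>y. integral\<^sup>L (lebesgue_on {0..y}) (\<lambda>x. F (vector [x, y])))"
    using lborel_pair.integral_snd[of "\<lambda>x y. f (x, y)"] i' conv(2)[OF ix[unfolded inner_x]] by (simp add: tf inner_x)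
  show "ref_int F = unit_int (\<lambda>x. integral\<^sup>L (lebesgue_on {x..1}) (\<lambda>y. F (vector [x, y])))"
    using lborel_pair.integral_fst[of "\<lambda>x y. f (x, y)"] i' conv(2)[OF iy[unfolded inner_y]] by (simp add: tf inner_y)
qed

section \<open>Continuously differentiable functions and affine changes of variables\<close>

lemma C1_grad_continuous:
  assumes "C1_grad V G"
  shows "continuous_on S V" "continuous_on S G" "continuous_on S (\<lambda>z. G z $ i)"
proof -
  have "continuous_on UNIV V"
    using assms by (auto simp: C1_grad_def continuous_on_eq_continuous_at intro: has_derivative_continuous)
  then show "continuous_on S V" by (rule continuous_on_subset) simp
  show G: "continuous_on S G"
    using assms by (auto simp: C1_grad_def intro: continuous_on_subset)
  show "continuous_on S (\<lambda>z. G z $ i)"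
    by (intro continuous_intros G)
qed

lemma C1_grad_deriv_line:
  assumes "C1_grad V G" "(c has_vector_derivative d) (at t)"
  shows "((\<lambda>t. V (c t)) has_real_derivative G (c t) \<bullet> d) (at t)"
proof -
  have "(V has_derivative (\<lambda>h. G (c t) \<bullet> h)) (at (c t))"
    using assms(1) by (simp add: C1_grad_def)
  from has_derivative_compose[OF assms(2)[unfolded has_vector_derivative_def] this]
  show ?thesis
    unfolding has_field_derivative_def by (rule has_derivative_eq_rhs) (simp add: fun_eq_iff)
qed

lemma vector2_has_vector_derivative:
  "((\<lambda>x. vector [x, y] :: real^2) has_vector_derivative axis 1 1) (at x)"
  "((\<lambda>y. vector [x, y] :: real^2) has_vector_derivative axis 2 1) (at y)"
  unfolding vector2_conv_scaleR by (auto intro!: derivative_eq_intros)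

lemma C1_grad_deriv_x:
  "C1_grad V G \<Longrightarrow> ((\<lambda>x. V (vector [x, y])) has_real_derivative G (vector [x, y]) $ 1) (at x)"
  using C1_grad_deriv_line[OF _ vector2_has_vector_derivative(1), of V G y x] by (simp add: inner_axis)

lemma C1_grad_deriv_y:
  "C1_grad V G \<Longrightarrow> ((\<lambda>y. V (vector [x, y])) has_real_derivative G (vector [x, y]) $ 2) (at y)"
  using C1_grad_deriv_line[OF _ vector2_has_vector_derivative(2), of V G x y] by (simp add: inner_axis)

lemma integral_lebesgue_on_FTC:
  fixes F :: "real \<Rightarrow> real"
  assumes "a \<le> b" "\<And>x. (F has_real_derivative f x) (at x)" "continuous_on {a..b} f"
  shows "integral\<^sup>L (lebesgue_on {a..b}) f = F b - F a"
proof -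
  have "integral\<^sup>L (lebesgue_on {a..b}) f = integral {a..b} f"
    by (rule lebesgue_integral_eq_integral[OF integrable_lebesgue_on_compact]) (use assms in auto)
  also have "\<dots> = F b - F a"
    by (intro integral_unique fundamental_theorem_of_calculus assms)
      (use assms(2) in \<open>auto simp: has_real_derivative_iff_has_vector_derivative
        intro: has_vector_derivative_at_within\<close>)
  finally show ?thesis .
qed

text \<open>The fundamental theorem of calculus on each slice: horizontal slices run from the left
  edge to the diagonal, vertical ones from the diagonal to the top edge. Hence the edge means
  determine the mean gradient.\<close>

lemma
  assumes "C1_grad V G"
  shows ref_int_grad_x: "ref_int (\<lambda>z. G z $ 1) = unit_int (\<lambda>t. V (vector [t, t])) - unit_int (\<lambda>t. V (vector [0, t]))"
    and ref_int_grad_y: "ref_int (\<lambda>z. G z $ 2) = unit_int (\<lambda>t. V (vector [t, 1])) - unit_int (\<lambda>t. V (vector [t, t]))"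
proof -
  have c: "continuous_on S (\<lambda>t. V (vector [f t, g t]))" "continuous_on S (\<lambda>t. G (vector [f t, g t]) $ i)"
    if "continuous_on S f" "continuous_on S g" for S f g i
    using that by (auto intro!: continuous_on_compose2[OF C1_grad_continuous(1)[OF assms, of UNIV]]
        continuous_on_compose2[OF C1_grad_continuous(2)[OF assms, of UNIV]] continuous_intros)
  have "ref_int (\<lambda>z. G z $ 1) = unit_int (\<lambda>y. V (vector [y, y]) - V (vector [0, y]))"
    unfolding ref_int_xy[OF C1_grad_continuous(3)[OF assms]]
    by (intro Bochner_Integration.integral_cong refl integral_lebesgue_on_FTC C1_grad_deriv_x assms c continuous_intros)
      auto
  then show "ref_int (\<lambda>z. G z $ 1) = unit_int (\<lambda>t. V (vector [t, t])) - unit_int (\<lambda>t. V (vector [0, t]))"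
    by (simp add: integrable_unit c continuous_intros)
  have "ref_int (\<lambda>z. G z $ 2) = unit_int (\<lambda>x. V (vector [x, 1]) - V (vector [x, x]))"
    unfolding ref_int_yx[OF C1_grad_continuous(3)[OF assms]]
    by (intro Bochner_Integration.integral_cong refl integral_lebesgue_on_FTC C1_grad_deriv_y assms c continuous_intros)
      auto
  then show "ref_int (\<lambda>z. G z $ 2) = unit_int (\<lambda>t. V (vector [t, 1])) - unit_int (\<lambda>t. V (vector [t, t]))"
    by (simp add: integrable_unit c continuous_intros)
qed

section \<open>Products, differences and affine substitutions\<close>

lemma C1_grad_mult:
  assumes "C1_grad V G" "C1_grad W H"
  shows "C1_grad (\<lambda>z. V z * W z) (\<lambda>z. V z *\<^sub>R H z + W z *\<^sub>R G z)"
  unfolding C1_grad_def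
proof (intro conjI allI)
  show "continuous_on UNIV (\<lambda>z. V z *\<^sub>R H z + W z *\<^sub>R G z)"
    by (intro continuous_intros C1_grad_continuous[OF assms(1)] C1_grad_continuous[OF assms(2)])
  fix x
  have "(V has_derivative (\<lambda>h. G x \<bullet> h)) (at x)" "(W has_derivative (\<lambda>h. H x \<bullet> h)) (at x)"
    using assms by (auto simp: C1_grad_def)
  from has_derivative_mult[OF this]
  show "((\<lambda>z. V z * W z) has_derivative (\<lambda>h. (V x *\<^sub>R H x + W x *\<^sub>R G x) \<bullet> h)) (at x)"
    by (simp add: inner_simps mult.commute)
qed

lemma C1_grad_affine: "C1_grad (\<lambda>z. a + b \<bullet> z) (\<lambda>_. b)"
  by (auto simp: C1_grad_def intro!: derivative_eq_intros)

lemma C1_grad_diff: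
  assumes "C1_grad V G" "C1_grad W H"
  shows "C1_grad (\<lambda>z. V z - W z) (\<lambda>z. G z - H z)"
  unfolding C1_grad_def
proof (intro conjI allI)
  show "continuous_on UNIV (\<lambda>z. G z - H z)"
    by (intro continuous_intros C1_grad_continuous[OF assms(1)] C1_grad_continuous[OF assms(2)])
  fix x
  have "(V has_derivative (\<lambda>h. G x \<bullet> h)) (at x)" "(W has_derivative (\<lambda>h. H x \<bullet> h)) (at x)"
    using assms by (auto simp: C1_grad_def)
  from has_derivative_diff[OF this]
  show "((\<lambda>z. V z - W z) has_derivative (\<lambda>h. (G x - H x) \<bullet> h)) (at x)"
    by (simp add: inner_simps)
qed

lemma C1_grad_compose_affine:
  fixes c p r :: "real^2"
  assumes "C1_grad V G"
  shows "C1_grad (\<lambda>z. V (c + z $ 1 *\<^sub>R p + z $ 2 *\<^sub>R r))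
    (\<lambda>z. vector [p \<bullet> G (c + z $ 1 *\<^sub>R p + z $ 2 *\<^sub>R r), r \<bullet> G (c + z $ 1 *\<^sub>R p + z $ 2 *\<^sub>R r)])"
  unfolding C1_grad_def
proof (intro conjI allI)
  let ?f = "\<lambda>z::real^2. c + z $ 1 *\<^sub>R p + z $ 2 *\<^sub>R r"
  show "continuous_on UNIV (\<lambda>z. vector [p \<bullet> G (?f z), r \<bullet> G (?f z)] :: real^2)"
    by (intro continuous_intros continuous_on_compose2[OF C1_grad_continuous(2)[OF assms, of UNIV]]) auto
  fix x
  have "(V has_derivative (\<lambda>h. G (?f x) \<bullet> h)) (at (?f x))"
    using assms by (auto simp: C1_grad_def)
  moreover have "(?f has_derivative (\<lambda>h. h $ 1 *\<^sub>R p + h $ 2 *\<^sub>R r)) (at x)"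
    by (auto intro!: derivative_eq_intros bounded_linear_imp_has_derivative bounded_linear_vec_nth)
  ultimately have "((\<lambda>z. V (?f z)) has_derivative (\<lambda>h. G (?f x) \<bullet> (h $ 1 *\<^sub>R p + h $ 2 *\<^sub>R r))) (at x)"
    using has_derivative_compose by blast
  then show "((\<lambda>z. V (?f z)) has_derivative (\<lambda>h. vector [p \<bullet> G (?f x), r \<bullet> G (?f x)] \<bullet> h)) (at x)"
    by (rule has_derivative_eq_rhs) (auto simp: inner_vec2 algebra_simps)
qed

lemma integral_affine_image:
  fixes c p r :: "real^2" and F :: "real^2 \<Rightarrow> real"
  defines "\<phi> \<equiv> \<lambda>z::real^2. c + z $ 1 *\<^sub>R p + z $ 2 *\<^sub>R r"
  assumes det: "p $ 1 * r $ 2 - p $ 2 * r $ 1 \<noteq> 0" and S: "compact S"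
    and F: "integrable (lebesgue_on (\<phi> ` S)) F"
  shows "integral\<^sup>L (lebesgue_on (\<phi> ` S)) F = \<bar>p $ 1 * r $ 2 - p $ 2 * r $ 1\<bar> * integral\<^sup>L (lebesgue_on S) (\<lambda>z. F (\<phi> z))"
proof -
  define L where "L = (\<lambda>h::real^2. h $ 1 *\<^sub>R p + h $ 2 *\<^sub>R r)"
  define D where "D = \<bar>p $ 1 * r $ 2 - p $ 2 * r $ 1\<bar>"
  have D: "D > 0" using det by (simp add: D_def)
  have der: "(\<phi> has_derivative L) (at z within A)" for z A
    unfolding \<phi>_def L_def
    by (auto intro!: derivative_eq_intros bounded_linear_imp_has_derivative bounded_linear_vec_nth)
  have detL: "\<bar>det (matrix L)\<bar> = D"
    by (simp add: det_2 matrix_def L_def D_def axis_def mult.commute)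
  have inj: "inj_on \<phi> A" for A
  proof (rule inj_onI)
    fix z w assume "\<phi> z = \<phi> w"
    then have e: "(z $ 1 - w $ 1) * p $ 1 + (z $ 2 - w $ 2) * r $ 1 = 0"
        "(z $ 1 - w $ 1) * p $ 2 + (z $ 2 - w $ 2) * r $ 2 = 0"
      by (auto simp: \<phi>_def vec2_eq_iff algebra_simps)
    \<comment> \<open>Cramer's rule for the difference of the two points.\<close>
    have "(z $ 1 - w $ 1) * (p $ 1 * r $ 2 - p $ 2 * r $ 1) = 0"
      "(z $ 2 - w $ 2) * (p $ 1 * r $ 2 - p $ 2 * r $ 1) = 0"
      using e by algebra+
    with det show "z = w" by (simp add: vec2_eq_iff)
  qed
  have "continuous_on S \<phi>"
    unfolding \<phi>_def by (intro continuous_intros)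
  then have "compact (\<phi> ` S)" using S by (rule compact_continuous_image)
  then have ms: "S \<in> sets lebesgue" "\<phi> ` S \<in> sets lebesgue"
    using S by (auto simp: compact_imp_closed)
  have abs_iff: "f absolutely_integrable_on A \<longleftrightarrow> integrable (lebesgue_on A) f"
    if "A \<in> sets lebesgue" for A and f :: "real^2 \<Rightarrow> real"
    using that by (simp add: integrable_restrict_space set_integrable_def)
  \<comment> \<open>The change-of-variables theorem concerns functions into a Cartesian space, so
    \<open>F\<close> is lifted to \<open>real^1\<close> and the result projected back to its only
    component.\<close>
  let ?h = "\<lambda>x::real. vec x :: real^1"
  have bl: "bounded_linear ?h"
    by (rule linear_conv_bounded_linear[THEN iffD1]) (rule linear_vec)
  have bl1: "bounded_linear (\<lambda>v::real^1. v $ 1)"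
    by (rule bounded_linear_vec_nth)
  have aF: "F absolutely_integrable_on \<phi> ` S"
    using F abs_iff[OF ms(2)] by simp
  have "(?h \<circ> F) absolutely_integrable_on \<phi> ` S"
    by (rule absolutely_integrable_linear[OF aF bl])
  moreover have "integral (\<phi> ` S) (?h \<circ> F) = ?h (integral (\<phi> ` S) F)"
    by (rule integral_linear[OF _ bl]) (use aF in \<open>simp add: absolutely_integrable_on_def\<close>)
  ultimately have
    1: "(\<lambda>x. D *\<^sub>R ?h (F (\<phi> x))) absolutely_integrable_on S" and
    2: "integral S (\<lambda>x. D *\<^sub>R ?h (F (\<phi> x))) = ?h (integral (\<phi> ` S) F)"
    using has_absolute_integral_change_of_variables[OF ms(1) der inj, of "?h \<circ> F" "?h (integral (\<phi> ` S) F)"]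
    by (auto simp: detL)
  have "((\<lambda>v. v $ 1) \<circ> (\<lambda>x. D *\<^sub>R ?h (F (\<phi> x)))) absolutely_integrable_on S"
    by (rule absolutely_integrable_linear[OF 1 bl1])
  then have 3: "(\<lambda>x. D * F (\<phi> x)) absolutely_integrable_on S"
    by (simp add: o_def)
  then have "integrable (lebesgue_on S) (\<lambda>x. D * F (\<phi> x))"
    using abs_iff[OF ms(1)] by simp
  with D have i: "integrable (lebesgue_on S) (\<lambda>z. F (\<phi> z))" by simp
  have "integral S ((\<lambda>v. v $ 1) \<circ> (\<lambda>x. D *\<^sub>R ?h (F (\<phi> x)))) = integral S (\<lambda>x. D *\<^sub>R ?h (F (\<phi> x))) $ 1"
    by (rule integral_linear[OF _ bl1]) (use 1 in \<open>simp add: absolutely_integrable_on_def\<close>)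
  then have "integral S (\<lambda>x. D * F (\<phi> x)) = integral (\<phi> ` S) F"
    by (simp only: 2 o_def vector_scaleR_component vec_component real_scaleR_def)
  moreover have "integral S (\<lambda>x. D * F (\<phi> x)) = D * integral S (\<lambda>x. F (\<phi> x))"
    by simp
  ultimately show "integral\<^sup>L (lebesgue_on (\<phi> ` S)) F = \<bar>p $ 1 * r $ 2 - p $ 2 * r $ 1\<bar> * integral\<^sup>L (lebesgue_on S) (\<lambda>z. F (\<phi> z))"
    using lebesgue_integral_eq_integral[OF F ms(2)] lebesgue_integral_eq_integral[OF i ms(1)]
    by (simp add: D_def)
qed

section \<open>A crude trace inequality\<close>

lemma compose_vector2_continuous:
  assumes "continuous_on UNIV F" "continuous_on S f" "continuous_on S g"
  shows "continuous_on S (\<lambda>t. F (vector [f t, g t] :: real^2))"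
  by (rule continuous_on_compose2[OF assms(1)]) (intro continuous_intros assms, simp)

section \<open>Integrals over the unit interval and squared increments\<close>

lemma measure_unit [simp]: "measure (lebesgue_on {0..1::real}) {0..1} = 1"
  by (simp add: measure_restrict_space)

lemma unit_int_const [simp]: "unit_int (\<lambda>_. c) = c"
  by simp

lemma unit_int_ident: "unit_int (\<lambda>t. t) = 1 / 2"
  by (subst integral_lebesgue_on_FTC[where F = "\<lambda>t. t\<^sup>2 / 2"])
    (auto intro!: derivative_eq_intros continuous_intros)

lemma unit_int_affine_sq: "unit_int (\<lambda>t. (t - 1/2)\<^sup>2) = 1 / 12"
  by (subst integral_lebesgue_on_FTC[where F = "\<lambda>t. (t - 1/2)^3 / 3"])
    (auto intro!: derivative_eq_intros continuous_intros simp: power2_eq_square power3_eq_cube)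

lemma ref_int_const [simp]: "ref_int (\<lambda>_. c) = c / 2"
proof -
  \<comment> \<open>The slice formula is applied to the linear function with values
    \<open>c * x\<close>, which vanishes on the left edge and equals \<open>c * t\<close> on the
    diagonal.\<close>
  have "ref_int (\<lambda>z. (axis 1 c :: real^2) $ 1) = c * unit_int (\<lambda>t. t)"
    using ref_int_grad_x[OF C1_grad_affine[of 0 "axis 1 c"]] by (simp add: inner_vec2 axis_def)
  then show ?thesis by (simp add: unit_int_ident axis_def)
qed

text \<open>Allowing \<open>c\<close> of either sign lets one substitution serve both the reflection
  and the halving of the interval.\<close>

lemma unit_int_lborel_affine:
  assumes f: "continuous_on UNIV f" and c: "c \<noteq> 0"
  shows "unit_int (\<lambda>t. f (a + c * t)) = inverse \<bar>c\<bar> * (\<integral>x. indicator {0..1} ((x - a) / c) * f x \<partial>lborel)"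
proof -
  have "unit_int (\<lambda>t. f (a + c * t)) = (\<integral>t. indicator {0..1} t * f (a + c * t) \<partial>lborel)"
    by (rule integral_lebesgue_on_lborel) (auto intro!: continuous_on_compose2[OF f] continuous_intros)
  moreover have "(\<integral>x. indicator {0..1} ((x - a) / c) * f x \<partial>lborel)
      = \<bar>c\<bar> * (\<integral>t. indicator {0..1} t * f (a + c * t) \<partial>lborel)"
    using lborel_integral_real_affine[of c "\<lambda>x. indicator {0..1} ((x - a) / c) * f x" a] c by simp
  ultimately show ?thesis using c by simp
qed

lemma unit_int_reflect:
  assumes f: "continuous_on UNIV f"
  shows "unit_int (\<lambda>t. f (1 - t)) = unit_int f"
proof -
  have "indicator {0..1} ((x - 1) / (-1)) = (indicator {0..1} x :: real)" for x :: real
    by (auto simp: indicator_def)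
  then show ?thesis
    using unit_int_lborel_affine[OF f, of "-1" 1] integral_lebesgue_on_lborel[of "{0..1}" f]
      continuous_on_subset[OF f] by simp
qed

lemma unit_int_halves:
  assumes f: "continuous_on UNIV f"
  shows "unit_int f = (unit_int (\<lambda>t. f (t / 2)) + unit_int (\<lambda>t. f (1/2 + t / 2))) / 2"
proof -
  have i: "integrable lborel (\<lambda>x. indicator {a..b} x * f x)" for a b
    using borel_integrable_compact[of "{a..b}" f] continuous_on_subset[OF f] by simp
  have 1: "indicator {0..1} ((x - 0) / (1/2)) = (indicator {0..1/2} x :: real)" for x :: real
    by (auto simp: indicator_def)
  have 2: "indicator {0..1} ((x - 1/2) / (1/2)) = (indicator {1/2..1} x :: real)" for x :: real
    by (auto simp: indicator_def)
  have "unit_int (\<lambda>t. f (t / 2)) = 2 * (\<integral>x. indicator {0..1/2} x * f x \<partial>lborel)"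
    using unit_int_lborel_affine[OF f, of "1/2" 0] unfolding 1 by simp
  moreover have "unit_int (\<lambda>t. f (1/2 + t / 2)) = 2 * (\<integral>x. indicator {1/2..1} x * f x \<partial>lborel)"
    using unit_int_lborel_affine[OF f, of "1/2" "1/2"] unfolding 2 by simp
  moreover have "unit_int f = (\<integral>x. indicator {0..1} x * f x \<partial>lborel)"
    using integral_lebesgue_on_lborel[of "{0..1}" f] continuous_on_subset[OF f] by simp
  moreover have "(\<integral>x. indicator {0..1} x * f x \<partial>lborel)
      = (\<integral>x. indicator {0..1/2} x * f x + indicator {1/2..1} x * f x \<partial>lborel)"
  proof (rule integral_cong_AE)
    \<comment> \<open>The two halves overlap only at the point \<open>1/2\<close>, a null
      set.\<close>
    show "AE x in lborel. indicator {0..1} x * f x = indicator {0..1/2} x * f x + indicator {1/2..1} x * f x"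
      using AE_lborel_singleton[of "1/2 :: real"] by eventually_elim (auto simp: indicator_def)
  qed (use i in \<open>auto intro: borel_measurable_integrable\<close>)
  ultimately show ?thesis using i by simp
qed

text \<open>Cauchy-Schwarz on a space of mass at most one, read off from the nonnegative integral of
  \<open>(f x - ?c)^2\<close> with \<open>?c\<close> the integral of \<open>f\<close>.\<close>

lemma sq_integral_le:
  assumes M: "finite_measure M" and i: "integrable M f" "integrable M (\<lambda>x. (f x)\<^sup>2 :: real)"
    and b: "measure M (space M) \<le> 1"
  shows "(integral\<^sup>L M f)\<^sup>2 \<le> integral\<^sup>L M (\<lambda>x. (f x)\<^sup>2)"
proof -
  interpret finite_measure M by fact
  let ?c = "integral\<^sup>L M f"
  have "0 \<le> integral\<^sup>L M (\<lambda>x. (f x - ?c)\<^sup>2)" by simp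
  also have "(\<lambda>x. (f x - ?c)\<^sup>2) = (\<lambda>x. (f x)\<^sup>2 - 2 * ?c * f x + ?c\<^sup>2)"
    by (simp add: power2_eq_square algebra_simps)
  also have "integral\<^sup>L M \<dots> = integral\<^sup>L M (\<lambda>x. (f x)\<^sup>2) - 2 * ?c * ?c + measure M (space M) * ?c\<^sup>2"
    using i by simp
  also have "\<dots> \<le> integral\<^sup>L M (\<lambda>x. (f x)\<^sup>2) - 2 * ?c * ?c + 1 * ?c\<^sup>2"
    using b by (intro add_left_mono mult_right_mono) auto
  finally show ?thesis by (simp add: power2_eq_square)
qed

text \<open>The increment is the integral of \<open>h'\<close> over \<open>{x..y}\<close>.
  Cauchy-Schwarz applies since this interval has length at most one, and enlarging it to
  \<open>{a..b}\<close> makes the bound independent of the starting point.\<close>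

lemma increment_sq_le:
  fixes h :: "real \<Rightarrow> real"
  assumes "\<And>x. (h has_real_derivative h' x) (at x)" "continuous_on UNIV h'"
    and "a \<le> x" "x \<le> y" "y \<le> b" "y - x \<le> 1"
  shows "(h y - h x)\<^sup>2 \<le> integral\<^sup>L (lebesgue_on {a..b}) (\<lambda>s. (h' s)\<^sup>2)"
proof -
  have c: "continuous_on S h'" for S using assms(2) continuous_on_subset by blast
  have i: "integrable (lebesgue_on {u..v}) h'" "integrable (lebesgue_on {u..v}) (\<lambda>s. (h' s)\<^sup>2)" for u v
    by (intro integrable_lebesgue_on_compact continuous_intros c; simp)+
  have "(h y - h x)\<^sup>2 = (integral\<^sup>L (lebesgue_on {x..y}) h')\<^sup>2"
    using integral_lebesgue_on_FTC[of x y h h'] assms c by simp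
  also have "\<dots> \<le> integral\<^sup>L (lebesgue_on {x..y}) (\<lambda>s. (h' s)\<^sup>2)"
    using assms by (intro sq_integral_le i) (auto intro!: finite_measureI simp: emeasure_restrict_space measure_restrict_space)
  also have "\<dots> = integral {x..y} (\<lambda>s. (h' s)\<^sup>2)"
    by (intro lebesgue_integral_eq_integral i) simp
  also have "\<dots> \<le> integral {a..b} (\<lambda>s. (h' s)\<^sup>2)"
    using assms c by (intro integral_subset_le) (auto intro!: integrable_continuous_interval continuous_intros)
  also have "\<dots> = integral\<^sup>L (lebesgue_on {a..b}) (\<lambda>s. (h' s)\<^sup>2)"
    by (intro lebesgue_integral_eq_integral[symmetric] i) simp
  finally show ?thesis .
qed

text \<open>The integrand is symmetric in the two coordinates and the triangle is half of the unit
  square. Over the square the cross term factors into a product of means and vanishes.\<close>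

lemma ref_int_sq_diff:
  assumes f: "continuous_on UNIV f" and m: "unit_int f = 0"
  shows "ref_int (\<lambda>z. (f (z $ 1) - f (z $ 2))\<^sup>2) = unit_int (\<lambda>t. (f t)\<^sup>2)"
proof -
  let ?F = "\<lambda>z::real^2. (f (z $ 1) - f (z $ 2))\<^sup>2"
  have cf: "continuous_on S f" for S using f continuous_on_subset by blast
  have F: "continuous_on UNIV ?F"
    by (intro continuous_intros continuous_on_compose2[OF f]) auto
  have split: "integral\<^sup>L (lebesgue_on {0..t}) g + integral\<^sup>L (lebesgue_on {t..1}) g = unit_int g"
    if "t \<in> {0..1}" "continuous_on UNIV g" for t and g :: "real \<Rightarrow> real"
  proof -
    have "continuous_on S g" for S using that continuous_on_subset by blast
    then have "integral\<^sup>L (lebesgue_on {u..v}) g = integral {u..v} g" "g integrable_on {u..v}" for u v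
      by (auto intro!: lebesgue_integral_eq_integral integrable_lebesgue_on_compact integrable_continuous_interval)
    then show ?thesis using that by (simp add: Henstock_Kurzweil_Integration.integral_combine)
  qed
  \<comment> \<open>One copy is sliced in each direction; the slices \<open>{0..t}\<close> and
    \<open>{t..1}\<close> then join to the full unit interval.\<close>
  have "ref_int ?F + ref_int ?F = unit_int (\<lambda>t. integral\<^sup>L (lebesgue_on {0..t}) (\<lambda>s. (f s - f t)\<^sup>2))
     + unit_int (\<lambda>t. integral\<^sup>L (lebesgue_on {t..1}) (\<lambda>s. (f t - f s)\<^sup>2))"
    using ref_int_xy[OF F] ref_int_yx[OF F] by simp
  also have "\<dots> = unit_int (\<lambda>t. integral\<^sup>L (lebesgue_on {0..t}) (\<lambda>s. (f s - f t)\<^sup>2)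
     + integral\<^sup>L (lebesgue_on {t..1}) (\<lambda>s. (f t - f s)\<^sup>2))"
    using integrable_xy[OF F] integrable_yx[OF F] by simp
  also have "\<dots> = unit_int (\<lambda>t. unit_int (\<lambda>s. (f s - f t)\<^sup>2))"
    by (intro Bochner_Integration.integral_cong refl)
      (subst (2) power2_commute, subst split, auto intro!: continuous_intros cf)
  also have "\<dots> = unit_int (\<lambda>t. unit_int (\<lambda>s. (f s)\<^sup>2) + (f t)\<^sup>2)"
  proof (intro Bochner_Integration.integral_cong refl)
    fix t
    have "unit_int (\<lambda>s. (f s - f t)\<^sup>2) = unit_int (\<lambda>s. (f s)\<^sup>2 - 2 * f t * f s + (f t)\<^sup>2)"
      by (simp add: power2_eq_square algebra_simps)
    also have "\<dots> = unit_int (\<lambda>s. (f s)\<^sup>2) - 2 * f t * unit_int f + (f t)\<^sup>2"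
      by (simp add: integrable_unit cf continuous_intros)
    finally show "unit_int (\<lambda>s. (f s - f t)\<^sup>2) = unit_int (\<lambda>s. (f s)\<^sup>2) + (f t)\<^sup>2"
      by (simp add: m)
  qed
  also have "\<dots> = 2 * unit_int (\<lambda>t. (f t)\<^sup>2)"
    by (simp add: integrable_unit cf continuous_intros)
  finally show ?thesis by simp
qed

text \<open>This supplies the starting constant of the iteration. The difference of the values at
  \<open>(x,x)\<close> and \<open>(y,y)\<close> passes through the value at \<open>(x,y)\<close>,
  and each of the two legs is controlled by one partial derivative.\<close>

lemma trace_sq_le:
  assumes V: "C1_grad V G" and m: "unit_int (\<lambda>t. V (vector [t, t])) = 0"
  shows "unit_int (\<lambda>t. (V (vector [t, t]))\<^sup>2) \<le> 2 * ref_int (\<lambda>z. (G z $ 1)\<^sup>2 + (G z $ 2)\<^sup>2)"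
proof -
  let ?f = "\<lambda>t. V (vector [t, t])"
  note cV = compose_vector2_continuous[OF C1_grad_continuous(1)[OF V]]
  note cG = compose_vector2_continuous[OF C1_grad_continuous(3)[OF V]]
  have cz: "continuous_on UNIV (\<lambda>z::real^2. ?f (z $ i))" for i
    by (intro cV continuous_intros)
  have cV0: "continuous_on UNIV V" and cG0: "continuous_on UNIV (\<lambda>z. G z $ i)" for i
    using C1_grad_continuous[OF V] by auto
  have X: "ref_int (\<lambda>z. (V z - ?f (z $ 2))\<^sup>2) \<le> ref_int (\<lambda>z. (G z $ 1)\<^sup>2)"
  proof -
    have "integral\<^sup>L (lebesgue_on {0..y}) (\<lambda>x. (V (vector [x, y]) - ?f y)\<^sup>2)
        \<le> integral\<^sup>L (lebesgue_on {0..y}) (\<lambda>x. (G (vector [x, y]) $ 1)\<^sup>2)" (is "_ \<le> ?I")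
      if "y \<in> {0..1}" for y
    proof -
      \<comment> \<open>The leg is the horizontal segment from \<open>(x,y)\<close> to
        \<open>(y,y)\<close>. Its bound no longer depends on \<open>x\<close>, so integrating over a
        slice of length \<open>y \<le> 1\<close> does not increase it.\<close>
      have "(V (vector [x, y]) - ?f y)\<^sup>2 \<le> ?I" if "x \<in> {0..y}" for x
        using increment_sq_le[OF C1_grad_deriv_x[OF V], of y 0 x y y] that \<open>y \<in> {0..1}\<close>
          cG[OF continuous_on_id continuous_on_const]
        by (subst power2_commute) simp
      then have "integral\<^sup>L (lebesgue_on {0..y}) (\<lambda>x. (V (vector [x, y]) - ?f y)\<^sup>2)
          \<le> integral\<^sup>L (lebesgue_on {0..y}) (\<lambda>x. ?I)"
        by (intro integral_mono integrable_lebesgue_on_compact continuous_intros cV) auto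
      also have "\<dots> = y * ?I" using that by (simp add: measure_restrict_space)
      also have "\<dots> \<le> 1 * ?I" using that by (intro mult_right_mono) auto
      finally show ?thesis by simp
    qed
    moreover have "continuous_on UNIV (\<lambda>z. (V z - ?f (z $ 2))\<^sup>2)" "continuous_on UNIV (\<lambda>z. (G z $ 1)\<^sup>2)"
      by (intro continuous_intros cV0 cG0 cz)+
    note ref_int_xy[OF this(1)] ref_int_xy[OF this(2)] integral_mono[OF integrable_xy[OF this(1)] integrable_xy[OF this(2)]]
    ultimately show ?thesis by simp
  qed
  have Y: "ref_int (\<lambda>z. (V z - ?f (z $ 1))\<^sup>2) \<le> ref_int (\<lambda>z. (G z $ 2)\<^sup>2)"
  proof -
    have "integral\<^sup>L (lebesgue_on {x..1}) (\<lambda>y. (V (vector [x, y]) - ?f x)\<^sup>2)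
        \<le> integral\<^sup>L (lebesgue_on {x..1}) (\<lambda>y. (G (vector [x, y]) $ 2)\<^sup>2)" (is "_ \<le> ?I")
      if "x \<in> {0..1}" for x
    proof -
      have "(V (vector [x, y]) - ?f x)\<^sup>2 \<le> ?I" if "y \<in> {x..1}" for y
        using increment_sq_le[OF C1_grad_deriv_y[OF V], of x x x y 1] that \<open>x \<in> {0..1}\<close>
          cG[OF continuous_on_const continuous_on_id]
        by simp
      then have "integral\<^sup>L (lebesgue_on {x..1}) (\<lambda>y. (V (vector [x, y]) - ?f x)\<^sup>2)
          \<le> integral\<^sup>L (lebesgue_on {x..1}) (\<lambda>y. ?I)"
        by (intro integral_mono integrable_lebesgue_on_compact continuous_intros cV) auto
      also have "\<dots> = (1 - x) * ?I" using that by (simp add: measure_restrict_space)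
      also have "\<dots> \<le> 1 * ?I" using that by (intro mult_right_mono) auto
      finally show ?thesis by simp
    qed
    moreover have "continuous_on UNIV (\<lambda>z. (V z - ?f (z $ 1))\<^sup>2)" "continuous_on UNIV (\<lambda>z. (G z $ 2)\<^sup>2)"
      by (intro continuous_intros cV0 cG0 cz)+
    note ref_int_yx[OF this(1)] ref_int_yx[OF this(2)] integral_mono[OF integrable_yx[OF this(1)] integrable_yx[OF this(2)]]
    ultimately show ?thesis by simp
  qed
  have "unit_int (\<lambda>t. (?f t)\<^sup>2) = ref_int (\<lambda>z. (?f (z $ 1) - ?f (z $ 2))\<^sup>2)"
    by (rule ref_int_sq_diff[symmetric]) (auto intro!: cV continuous_intros m)
  also have "\<dots> \<le> ref_int (\<lambda>z. 2 * (V z - ?f (z $ 1))\<^sup>2 + 2 * (V z - ?f (z $ 2))\<^sup>2)"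
  proof (intro integral_mono integrable_ref_tri continuous_intros cz cV0)
    fix z
    have "(a - b)\<^sup>2 \<le> 2 * (v - a)\<^sup>2 + 2 * (v - b)\<^sup>2" for a b v :: real
      using zero_le_power2[of "2 * v - a - b"] by (simp add: power2_eq_square algebra_simps)
    then show "(?f (z $ 1) - ?f (z $ 2))\<^sup>2 \<le> 2 * (V z - ?f (z $ 1))\<^sup>2 + 2 * (V z - ?f (z $ 2))\<^sup>2" .
  qed
  also have "\<dots> = 2 * ref_int (\<lambda>z. (V z - ?f (z $ 1))\<^sup>2) + 2 * ref_int (\<lambda>z. (V z - ?f (z $ 2))\<^sup>2)"
    by (simp add: integrable_ref_tri continuous_intros cz cV0)
  also have "\<dots> \<le> 2 * ref_int (\<lambda>z. (G z $ 2)\<^sup>2) + 2 * ref_int (\<lambda>z. (G z $ 1)\<^sup>2)"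
    using X Y by simp
  also have "\<dots> = 2 * ref_int (\<lambda>z. (G z $ 1)\<^sup>2 + (G z $ 2)\<^sup>2)"
    by (simp add: integrable_ref_tri continuous_intros cG0)
  finally show ?thesis .
qed

section \<open>Self-improvement by subdivision\<close>

lemma measure_ref_tri [simp]: "measure (lebesgue_on ref_tri) ref_tri = 1/2"
  using ref_int_const[of 1] by simp

text \<open>Up to a factor, the Dirichlet form of the equilateral triangle in the coordinates of \<open>ref_tri\<close>.\<close>

definition equi_form :: "real^2 \<Rightarrow> real" where
  "equi_form p = (p $ 1)\<^sup>2 + (p $ 2)\<^sup>2 + (p $ 1 + p $ 2)\<^sup>2"

lemma equi_form_nonneg: "0 \<le> equi_form p"
  by (simp add: equi_form_def)

lemma continuous_on_equi_form [continuous_intros]: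
  "continuous_on S f \<Longrightarrow> continuous_on S (\<lambda>x. equi_form (f x))"
  unfolding equi_form_def by (intro continuous_intros)

text \<open>With \<open>k = 1/2\<close> these maps give the three corner triangles, with \<open>k = -1/2\<close> the middle one.\<close>

abbreviation sub_map :: "real \<Rightarrow> real \<Rightarrow> real \<Rightarrow> real^2 \<Rightarrow> real^2" where
  "sub_map c d k z \<equiv> vector [c + k * z $ 1, d + k * z $ 2]"

lemma sub_map_eq: "sub_map c d k z = vector [c, d] + z $ 1 *\<^sub>R axis 1 k + z $ 2 *\<^sub>R axis 2 k"
  by (simp add: vec2_eq_iff axis_def)

lemma C1_grad_sub_map:
  assumes "C1_grad V G"
  shows "C1_grad (\<lambda>z. V (sub_map c d k z)) (\<lambda>z. k *\<^sub>R G (sub_map c d k z))"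
proof -
  have "vector [axis 1 k \<bullet> w, axis 2 k \<bullet> w] = k *\<^sub>R w" for w :: "real^2"
    by (simp add: vec2_eq_iff inner_vec2 axis_def)
  then show ?thesis
    using C1_grad_compose_affine[OF assms, of "vector [c, d]" "axis 1 k" "axis 2 k"]
    unfolding sub_map_eq by simp
qed

text \<open>The four images lie in the triangle and overlap only on lines, and each substitution has
  Jacobian \<open>1/4\<close>. For nonnegative \<open>F\<close> this gives the inequality.\<close>

lemma ref_int_subdivide:
  assumes F: "continuous_on UNIV F" and pos: "\<And>z. 0 \<le> F z"
  shows "(ref_int (\<lambda>z. F (sub_map 0 0 (1/2) z)) + ref_int (\<lambda>z. F (sub_map (1/2) (1/2) (1/2) z))
     + ref_int (\<lambda>z. F (sub_map 0 (1/2) (1/2) z)) + ref_int (\<lambda>z. F (sub_map (1/2) 1 (-(1/2)) z))) / 4 \<le> ref_int F"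
proof -
  have cF: "continuous_on S F" for S using F continuous_on_subset by blast
  have cpt: "compact (sub_map c d k ` ref_tri)" for c d k
    by (intro compact_continuous_image compact_ref_tri continuous_intros)
  have ms: "sub_map c d k ` ref_tri \<in> sets lebesgue" for c d k
    by (rule fmeasurableD[OF lmeasurable_compact[OF cpt]])
  have i: "integrable lebesgue (\<lambda>z. indicator (sub_map c d k ` ref_tri) z * F z)" for c d k
    using integrable_lebesgue_on_compact[OF cpt cF, of c k d] ms[of c k d] by (simp add: integrable_restrict_space)
  have iT: "integrable lebesgue (\<lambda>z. indicator ref_tri z * F z)"
    using integrable_lebesgue_on_compact[OF compact_ref_tri cF] by (simp add: integrable_restrict_space)
  have *: "ref_int (\<lambda>z. F (sub_map c d k z)) / 4 = (\<integral>z. indicator (sub_map c d k ` ref_tri) z * F z \<partial>lebesgue)"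
    if k: "k = 1/2 \<or> k = -(1/2)" for c d k
  proof -
    have k2: "k * k = 1/4" using k by (elim disjE; hypsubst) simp_all
    have "(axis 1 k :: real^2) $ 1 * (axis 2 k :: real^2) $ 2 - (axis 1 k :: real^2) $ 2 * (axis 2 k :: real^2) $ 1 = 1/4"
      by (simp add: axis_def k2)
    with integral_affine_image[OF _ compact_ref_tri, of "axis 1 k" "axis 2 k" "vector [c, d]" F]
    have "integral\<^sup>L (lebesgue_on (sub_map c d k ` ref_tri)) F = 1/4 * ref_int (\<lambda>z. F (sub_map c d k z))"
      using integrable_lebesgue_on_compact[OF cpt cF, of c k d] unfolding sub_map_eq by simp
    then show ?thesis
      using ms[of c k d] by (simp add: integral_restrict_space)
  qed
  have ae: "AE z in lebesgue. w \<bullet> z \<noteq> b" if "w \<noteq> 0" for w :: "real^2" and b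
    using negligible_hyperplane[of w b] that
    by (intro AE_I'[of "{z. w \<bullet> z = b}"]) (auto simp: negligible_iff_null_sets)
  let ?A = "\<lambda>c d k z. indicator (sub_map c d k ` ref_tri) z * F z"
  have "(\<integral>z. ?A 0 0 (1/2) z + ?A (1/2) (1/2) (1/2) z + ?A 0 (1/2) (1/2) z + ?A (1/2) 1 (-(1/2)) z \<partial>lebesgue)
     \<le> (\<integral>z. indicator ref_tri z * F z \<partial>lebesgue)"
  proof (rule integral_mono_AE)
    \<comment> \<open>These are the normals of the cutting lines \<open>x = 1/2\<close>,
      \<open>y = 1/2\<close> and \<open>y - x = 1/2\<close>. Off these lines a point belongs to at
      most one of the four pieces.\<close>
    have "vector [1, 0] \<noteq> (0 :: real^2)" "vector [0, 1] \<noteq> (0 :: real^2)" "vector [-1, 1] \<noteq> (0 :: real^2)"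
      by (auto simp: vec2_eq_iff)
    from this[THEN ae, of "1/2"]
    show "AE z in lebesgue. ?A 0 0 (1/2) z + ?A (1/2) (1/2) (1/2) z + ?A 0 (1/2) (1/2) z + ?A (1/2) 1 (-(1/2)) z
        \<le> indicator ref_tri z * F z"
    proof eventually_elim
      case (elim z)
      then have ne: "z $ 1 \<noteq> 1/2" "z $ 2 \<noteq> 1/2" "z $ 2 - z $ 1 \<noteq> 1/2"
        by (auto simp: inner_vec2)
      have 1: "z \<in> sub_map 0 0 (1/2) ` ref_tri \<Longrightarrow> 0 \<le> z $ 1 \<and> z $ 1 \<le> z $ 2 \<and> z $ 2 \<le> 1/2"
        by (auto simp: ref_tri_def)
      have 2: "z \<in> sub_map (1/2) (1/2) (1/2) ` ref_tri \<Longrightarrow> 1/2 \<le> z $ 1 \<and> z $ 1 \<le> z $ 2 \<and> z $ 2 \<le> 1"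
        by (auto simp: ref_tri_def)
      have 3: "z \<in> sub_map 0 (1/2) (1/2) ` ref_tri \<Longrightarrow> 0 \<le> z $ 1 \<and> z $ 1 + 1/2 \<le> z $ 2 \<and> z $ 2 \<le> 1"
        by (auto simp: ref_tri_def)
      have 4: "z \<in> sub_map (1/2) 1 (-(1/2)) ` ref_tri \<Longrightarrow> z $ 1 \<le> 1/2 \<and> 1/2 \<le> z $ 2 \<and> z $ 2 \<le> z $ 1 + 1/2
          \<and> 0 \<le> z $ 1 \<and> z $ 2 \<le> 1"
        by (auto simp: ref_tri_def)
      have mem: "z \<in> ref_tri \<longleftrightarrow> 0 \<le> z $ 1 \<and> z $ 1 \<le> z $ 2 \<and> z $ 2 \<le> 1"
        by (simp add: ref_tri_def)
      consider "z \<in> sub_map 0 0 (1/2) ` ref_tri" | "z \<in> sub_map (1/2) (1/2) (1/2) ` ref_tri" | "z \<in> sub_map 0 (1/2) (1/2) ` ref_tri"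
        | "z \<in> sub_map (1/2) 1 (-(1/2)) ` ref_tri"
        | "z \<notin> sub_map 0 0 (1/2) ` ref_tri" "z \<notin> sub_map (1/2) (1/2) (1/2) ` ref_tri" "z \<notin> sub_map 0 (1/2) (1/2) ` ref_tri"
          "z \<notin> sub_map (1/2) 1 (-(1/2)) ` ref_tri"
        by blast
      then show ?case
      proof cases
        case a: 1
        have "z \<notin> sub_map (1/2) (1/2) (1/2) ` ref_tri" "z \<notin> sub_map 0 (1/2) (1/2) ` ref_tri"
          "z \<notin> sub_map (1/2) 1 (-(1/2)) ` ref_tri"
          using 1[OF a] ne by - (rule notI, (drule 2 | drule 3 | drule 4), elim conjE, linarith)+
        moreover have "z \<in> ref_tri" using 1[OF a] unfolding mem by auto
        ultimately show ?thesis using a by simp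
      next
        case a: 2
        have "z \<notin> sub_map 0 0 (1/2) ` ref_tri" "z \<notin> sub_map 0 (1/2) (1/2) ` ref_tri"
          "z \<notin> sub_map (1/2) 1 (-(1/2)) ` ref_tri"
          using 2[OF a] ne by - (rule notI, (drule 1 | drule 3 | drule 4), elim conjE, linarith)+
        moreover have "z \<in> ref_tri" using 2[OF a] unfolding mem by auto
        ultimately show ?thesis using a by simp
      next
        case a: 3
        have "z \<notin> sub_map 0 0 (1/2) ` ref_tri" "z \<notin> sub_map (1/2) (1/2) (1/2) ` ref_tri"
          "z \<notin> sub_map (1/2) 1 (-(1/2)) ` ref_tri"
          using 3[OF a] ne by - (rule notI, (drule 1 | drule 2 | drule 4), elim conjE, linarith)+
        moreover have "z \<in> ref_tri" using 3[OF a] unfolding mem by auto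
        ultimately show ?thesis using a by simp
      next
        case a: 4
        have "z \<notin> sub_map 0 0 (1/2) ` ref_tri" "z \<notin> sub_map (1/2) (1/2) (1/2) ` ref_tri"
          "z \<notin> sub_map 0 (1/2) (1/2) ` ref_tri"
          using 4[OF a] ne by - (rule notI, (drule 1 | drule 2 | drule 3), elim conjE, linarith)+
        moreover have "z \<in> ref_tri" using 4[OF a] unfolding mem by auto
        ultimately show ?thesis using a by simp
      next
        case 5
        then show ?thesis using pos by simp
      qed
    qed
  qed (intro Bochner_Integration.integrable_add i iT)+
  moreover have "ref_int F = (\<integral>z. indicator ref_tri z * F z \<partial>lebesgue)"
    by (subst integral_restrict_space) auto
  ultimately show ?thesis
    unfolding add_divide_distrib *[OF disjI1[OF refl]] *[OF disjI2[OF refl]]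
    by (simp only: Bochner_Integration.integral_add Bochner_Integration.integrable_add i)
qed

section \<open>Edge means and the Crouzeix-Raviart splitting on the reference triangle\<close>

abbreviation diag_mean :: "(real^2 \<Rightarrow> real) \<Rightarrow> real" where
  "diag_mean V \<equiv> unit_int (\<lambda>t. V (vector [t, t]))"

abbreviation left_mean :: "(real^2 \<Rightarrow> real) \<Rightarrow> real" where
  "left_mean V \<equiv> unit_int (\<lambda>t. V (vector [0, t]))"

abbreviation top_mean :: "(real^2 \<Rightarrow> real) \<Rightarrow> real" where
  "top_mean V \<equiv> unit_int (\<lambda>t. V (vector [t, 1]))"

text \<open>The gradient of the Crouzeix-Raviart interpolant, equal to the mean of the gradient of
  \<open>V\<close>. The factor 2 is the inverse of the area \<open>1/2\<close>.\<close>

definition interp_grad :: "(real^2 \<Rightarrow> real) \<Rightarrow> real^2" where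
  "interp_grad V = vector [2 * (diag_mean V - left_mean V), 2 * (top_mean V - diag_mean V)]"

text \<open>Stated as a property of the constant, so that the subdivision step can be iterated on
  it.\<close>

definition trace_bound :: "real \<Rightarrow> bool" where
  "trace_bound \<Gamma> \<longleftrightarrow> (\<forall>V G. C1_grad V G \<longrightarrow> diag_mean V = 0 \<longrightarrow> left_mean V = 0 \<longrightarrow> top_mean V = 0 \<longrightarrow>
     unit_int (\<lambda>t. (V (vector [t, t]))\<^sup>2) \<le> \<Gamma> * ref_int (\<lambda>z. equi_form (G z)))"

text \<open>Since \<open>interp_grad V\<close> is the mean of \<open>G\<close>, the cross terms
  integrate to zero. Taking \<open>b = 0\<close> splits the energy of \<open>V\<close>; a general
  \<open>b\<close> shows that the interpolation gradient is the best constant.\<close>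

lemma energy_split:
  assumes V: "C1_grad V G"
  shows "ref_int (\<lambda>z. equi_form (G z - b))
    = ref_int (\<lambda>z. equi_form (G z - interp_grad V)) + equi_form (interp_grad V - b) / 2"
proof -
  define p where "p = interp_grad V"
  \<comment> \<open>\<open>l\<close> and \<open>r\<close> are half the partial derivatives of
    \<open>equi_form\<close> at \<open>p - b\<close>.\<close>
  define l where "l = 2 * (p $ 1 - b $ 1) + (p $ 2 - b $ 2)"
  define r where "r = (p $ 1 - b $ 1) + 2 * (p $ 2 - b $ 2)"
  note c = C1_grad_continuous[OF V]
  have "equi_form (G z - b) = equi_form (G z - p) + 2 * l * (G z $ 1 - p $ 1) + 2 * r * (G z $ 2 - p $ 2)
      + equi_form (p - b)" for z
    unfolding equi_form_def l_def r_def by (simp add: power2_eq_square algebra_simps)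
  then have "ref_int (\<lambda>z. equi_form (G z - b)) = ref_int (\<lambda>z. equi_form (G z - p) + 2 * l * (G z $ 1 - p $ 1)
      + 2 * r * (G z $ 2 - p $ 2) + equi_form (p - b))"
    by simp
  also have "\<dots> = ref_int (\<lambda>z. equi_form (G z - p)) + 2 * l * (ref_int (\<lambda>z. G z $ 1) - p $ 1 / 2)
      + 2 * r * (ref_int (\<lambda>z. G z $ 2) - p $ 2 / 2) + equi_form (p - b) / 2"
    by (simp add: integrable_ref_tri continuous_intros c)
  moreover have "ref_int (\<lambda>z. G z $ 1) = p $ 1 / 2" "ref_int (\<lambda>z. G z $ 2) = p $ 2 / 2"
    using ref_int_grad_x[OF V] ref_int_grad_y[OF V] by (auto simp: p_def interp_grad_def)
  ultimately show ?thesis by (simp add: p_def)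
qed

lemma energy_interp:
  assumes V: "C1_grad V G"
  shows "ref_int (\<lambda>z. equi_form (G z)) = ref_int (\<lambda>z. equi_form (G z - interp_grad V))
    + 2 * ((diag_mean V - left_mean V)\<^sup>2 + (top_mean V - diag_mean V)\<^sup>2 + (top_mean V - left_mean V)\<^sup>2)"
  using energy_split[OF V, of 0]
  by (simp add: equi_form_def interp_grad_def) (simp add: power2_eq_square algebra_simps)

text \<open>Subtracting the interpolant makes all three edge means vanish. Along the diagonal the
  interpolant is affine with the same mean as \<open>V\<close> and slope
  \<open>p $ 1 + p $ 2\<close>.\<close>

lemma trace_bound_interp:
  assumes P: "trace_bound \<Gamma>" and V: "C1_grad V G"
  shows "unit_int (\<lambda>t. (V (vector [t, t]) - (diag_mean V + 2 * (top_mean V - left_mean V) * (t - 1/2)))\<^sup>2)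
    \<le> \<Gamma> * ref_int (\<lambda>z. equi_form (G z - interp_grad V))"
proof -
  define p where "p = interp_grad V"
  \<comment> \<open>The constant is fixed by the diagonal mean, since both coordinates have mean
    \<open>1/2\<close> there. The choice of \<open>p\<close> then settles the other two
    edges.\<close>
  define a where "a = diag_mean V - (p $ 1 + p $ 2) / 2"
  define W where "W = (\<lambda>z. V z - (a + p \<bullet> z))"
  have W: "C1_grad W (\<lambda>z. G z - p)"
    unfolding W_def by (intro C1_grad_diff V C1_grad_affine)
  have c: "integrable (lebesgue_on {0..1}) (\<lambda>t. V (vector [f t, g t]))"
    if "continuous_on {0..1} f" "continuous_on {0..1} g" for f g :: "real \<Rightarrow> real"
    using that by (intro integrable_unit compose_vector2_continuous C1_grad_continuous[OF V])
  have "integrable (lebesgue_on {0..1}) (\<lambda>t::real. t)"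
    by (intro integrable_unit continuous_intros)
  note i = c[OF continuous_on_id continuous_on_id] c[OF continuous_on_id continuous_on_const]
    c[OF continuous_on_const continuous_on_id] this
  have "diag_mean W = 0" "left_mean W = 0" "top_mean W = 0"
    using i unfolding W_def inner_vec2
    by (auto simp: unit_int_ident a_def p_def interp_grad_def add_divide_distrib diff_divide_distrib)
  then have "unit_int (\<lambda>t. (W (vector [t, t]))\<^sup>2) \<le> \<Gamma> * ref_int (\<lambda>z. equi_form (G z - p))"
    using P W unfolding trace_bound_def by blast
  moreover have "W (vector [t, t]) = V (vector [t, t]) - (diag_mean V + 2 * (top_mean V - left_mean V) * (t - 1/2))" for t
    by (simp add: W_def inner_vec2 a_def p_def interp_grad_def algebra_simps) (simp add: field_simps)
  ultimately show ?thesis by (simp add: p_def)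
qed

text \<open>The trace is split into its mean, a multiple of \<open>t - 1/2\<close>, and the
  interpolation error. The mean separates exactly by orthogonality; the other two parts are
  separated by a weighted Young inequality.\<close>

lemma trace_bound_imp_le:
  assumes P: "trace_bound \<Gamma>" and V: "C1_grad V G"
  shows "unit_int (\<lambda>t. (V (vector [t, t]))\<^sup>2)
    \<le> (diag_mean V)\<^sup>2 + 4/3 * (top_mean V - left_mean V)\<^sup>2 + 4/3 * \<Gamma> * ref_int (\<lambda>z. equi_form (G z - interp_grad V))"
proof -
  define m where "m = diag_mean V"
  define s where "s = 2 * (top_mean V - left_mean V)"
  let ?f = "\<lambda>t. V (vector [t, t])"
  have f: "continuous_on S ?f" for S
    by (intro compose_vector2_continuous C1_grad_continuous[OF V] continuous_intros)
  have "unit_int (\<lambda>t. (?f t)\<^sup>2) = unit_int (\<lambda>t. (?f t - m)\<^sup>2 + 2 * m * ?f t - m\<^sup>2)"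
    by (simp add: power2_eq_square algebra_simps)
  also have "\<dots> = unit_int (\<lambda>t. (?f t - m)\<^sup>2) + m\<^sup>2"
    by (simp add: integrable_unit continuous_intros f m_def[symmetric]) (simp add: power2_eq_square)
  also have "unit_int (\<lambda>t. (?f t - m)\<^sup>2) \<le> unit_int (\<lambda>t. 4 * s\<^sup>2 * (t - 1/2)\<^sup>2 + 4/3 * (?f t - (m + s * (t - 1/2)))\<^sup>2)"
  proof (intro integral_mono integrable_unit continuous_intros f)
    fix t
    \<comment> \<open>The weight \<open>4/3\<close> on the error becomes the contraction factor
      \<open>2/3\<close> once averaged over two half edges. The weight \<open>4\<close> on the
      linear part, whose square has mean \<open>s^2 / 12\<close>, gives a term that
      \<open>subdivision_form_le\<close> still absorbs.\<close>
    have "(x + y)\<^sup>2 \<le> 4 * x\<^sup>2 + 4/3 * y\<^sup>2" for x y :: real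
      using zero_le_power2[of "3 * x - y"] by (simp add: power2_eq_square algebra_simps)
    from this[of "s * (t - 1/2)" "?f t - (m + s * (t - 1/2))"]
    show "(?f t - m)\<^sup>2 \<le> 4 * s\<^sup>2 * (t - 1/2)\<^sup>2 + 4/3 * (?f t - (m + s * (t - 1/2)))\<^sup>2"
      by (simp add: power_mult_distrib)
  qed
  also have "\<dots> = s\<^sup>2 / 3 + 4/3 * unit_int (\<lambda>t. (?f t - (m + s * (t - 1/2)))\<^sup>2)"
    by (subst Bochner_Integration.integral_add)
      (auto intro!: integrable_unit continuous_intros f simp: unit_int_affine_sq)
  finally have "unit_int (\<lambda>t. (?f t)\<^sup>2) \<le> s\<^sup>2 / 3 + 4/3 * unit_int (\<lambda>t. (?f t - (m + s * (t - 1/2)))\<^sup>2) + m\<^sup>2"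
    by simp
  also have "\<dots> \<le> s\<^sup>2 / 3 + 4/3 * (\<Gamma> * ref_int (\<lambda>z. equi_form (G z - interp_grad V))) + m\<^sup>2"
    using trace_bound_interp[OF P V] by (simp add: m_def s_def)
  finally have "unit_int (\<lambda>t. (?f t)\<^sup>2) \<le> s\<^sup>2 / 3 + 4/3 * (\<Gamma> * ref_int (\<lambda>z. equi_form (G z - interp_grad V))) + m\<^sup>2" .
  moreover have "s\<^sup>2 = 4 * (top_mean V - left_mean V)\<^sup>2"
    unfolding s_def power_mult_distrib by simp
  ultimately show ?thesis
    by (simp add: m_def mult.assoc)
qed

text \<open>Here \<open>\<alpha>\<close>, \<open>\<beta>\<close>, \<open>\<gamma>\<close> are the means over one half of each outer edge (the other half has the
  opposite mean), and \<open>a\<close>, \<open>b\<close>, \<open>c\<close> the means over the inner edges. The sum of squares in the proof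
  comes from splitting the variables into parts even and odd under reflection in the bisector of
  the diagonal.\<close>

lemma subdivision_form_le:
  fixes \<alpha> \<beta> \<gamma> a b c :: real
  shows "\<alpha>\<^sup>2 + 2/3 * ((a - \<beta>)\<^sup>2 + (\<gamma> - b)\<^sup>2) \<le> 4/9 *
   (((\<alpha> - \<beta>)\<^sup>2 + (a - \<alpha>)\<^sup>2 + (a - \<beta>)\<^sup>2) + ((- \<alpha> - b)\<^sup>2 + (\<gamma> + \<alpha>)\<^sup>2 + (\<gamma> - b)\<^sup>2)
    + ((c + \<beta>)\<^sup>2 + (- \<gamma> - c)\<^sup>2 + (\<beta> - \<gamma>)\<^sup>2) + ((c - b)\<^sup>2 + (a - c)\<^sup>2 + (a - b)\<^sup>2))"
    (is "?l \<le> ?r")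
proof -
  have "?r - ?l = 4/9 * (((a + b + \<beta> + \<gamma>) / 2)\<^sup>2 + 2 * (c + (\<beta> + \<gamma>) / 2)\<^sup>2 + 2 * ((a + b) / 2 - c)\<^sup>2
     + (a - b + \<beta> - \<gamma> - \<alpha>)\<^sup>2 + 3/4 * \<alpha>\<^sup>2 + 3 * ((a - b - \<beta> + \<gamma>) / 2)\<^sup>2)"
    by (simp add: power2_eq_square field_simps)
  also have "\<dots> \<ge> 0" by simp
  finally show ?thesis by simp
qed

text \<open>The traces on the two corner triangles along the diagonal are bounded by
  \<open>trace_bound_imp_le\<close>. Their means and slopes are paid for by the interpolant energies
  of all four pieces at the rate \<open>2/9\<close>, and the errors by the remainder energies at the
  rate \<open>2/3 * \<Gamma>\<close>.\<close>

lemma trace_bound_step: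
  assumes P: "trace_bound \<Gamma>" and \<Delta>: "2/9 \<le> \<Delta>" "2/3 * \<Gamma> \<le> \<Delta>"
  shows "trace_bound \<Delta>"
  unfolding trace_bound_def
proof (intro allI impI)
  fix V G
  assume V: "C1_grad V G" and m0: "diag_mean V = 0" "left_mean V = 0" "top_mean V = 0"
  have cV: "continuous_on UNIV (\<lambda>t. V (vector [f t, g t]))"
    if "continuous_on UNIV f" "continuous_on UNIV g" for f g :: "real \<Rightarrow> real"
    using that by (intro compose_vector2_continuous C1_grad_continuous[OF V])
  let ?V1 = "\<lambda>z. V (sub_map 0 0 (1/2) z)" and ?V2 = "\<lambda>z. V (sub_map (1/2) (1/2) (1/2) z)"
  let ?V3 = "\<lambda>z. V (sub_map 0 (1/2) (1/2) z)" and ?V4 = "\<lambda>z. V (sub_map (1/2) 1 (-(1/2)) z)"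
  let ?G = "\<lambda>c d k z. k *\<^sub>R G (sub_map c d k z)"
  have V1: "C1_grad ?V1 (?G 0 0 (1/2))" and V2: "C1_grad ?V2 (?G (1/2) (1/2) (1/2))"
    and V3: "C1_grad ?V3 (?G 0 (1/2) (1/2))" and V4: "C1_grad ?V4 (?G (1/2) 1 (-(1/2)))"
    by (intro C1_grad_sub_map V)+
  define \<alpha> \<beta> \<gamma> a b c where "\<alpha> = diag_mean ?V1" and "\<beta> = left_mean ?V1" and "\<gamma> = top_mean ?V2"
    and "a = top_mean ?V1" and "b = left_mean ?V2" and "c = diag_mean ?V3"
  note defs = this
  \<comment> \<open>Each outer edge has mean zero, so the means over its two halves cancel.\<close>
  have e2: "diag_mean ?V2 = - \<alpha>"
    using unit_int_halves[OF cV[OF continuous_on_id continuous_on_id]] m0 by (simp add: defs)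
  have e3: "left_mean ?V3 = - \<beta>"
    using unit_int_halves[OF cV[OF continuous_on_const continuous_on_id], of 0] m0 by (simp add: defs)
  have e3': "top_mean ?V3 = - \<gamma>"
    using unit_int_halves[OF cV[OF continuous_on_id continuous_on_const], of 1] m0 by (simp add: defs)
  \<comment> \<open>The middle triangle is turned by 180 degrees, so it shares each inner edge with
    a corner triangle but runs along it backwards.\<close>
  have e4: "diag_mean ?V4 = c" "left_mean ?V4 = b" "top_mean ?V4 = a"
    using unit_int_reflect[OF cV[of "\<lambda>t. t / 2" "\<lambda>t. 1/2 + t / 2"]]
      unit_int_reflect[OF cV[of "\<lambda>t. 1/2" "\<lambda>t. 1/2 + t / 2"]]
      unit_int_reflect[OF cV[of "\<lambda>t. t / 2" "\<lambda>t. 1/2"]]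
    by (auto simp: defs continuous_intros diff_divide_distrib algebra_simps)
  have cE: "continuous_on UNIV (\<lambda>z. equi_form (G z))"
    by (intro continuous_intros C1_grad_continuous[OF V])
  let ?E = "\<lambda>H. ref_int (\<lambda>z. equi_form (H z))"
  \<comment> \<open>The factor \<open>k^2 = 1/4\<close> from the gradients matches the Jacobian in
    \<open>ref_int_subdivide\<close>: Dirichlet energy is scale invariant in the plane.\<close>
  have sc: "?E (?G u d k) = ?E (\<lambda>z. G (sub_map u d k z)) / 4" if "k = 1/2 \<or> k = -(1/2)" for u d k
  proof -
    have "equi_form (k *\<^sub>R p) = equi_form p / 4" for p
    proof -
      have "k\<^sup>2 = 1/4" using that by (elim disjE; hypsubst) (simp_all add: power2_eq_square)
      moreover have "equi_form (k *\<^sub>R p) = k\<^sup>2 * equi_form p"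
        by (simp add: equi_form_def power2_eq_square algebra_simps)
      ultimately show ?thesis by simp
    qed
    then show ?thesis by (simp only: integral_divide_zero)
  qed
  have E: "?E (?G 0 0 (1/2)) + ?E (?G (1/2) (1/2) (1/2)) + ?E (?G 0 (1/2) (1/2)) + ?E (?G (1/2) 1 (-(1/2))) \<le> ?E G"
    using ref_int_subdivide[OF cE equi_form_nonneg]
    unfolding add_divide_distrib sc[OF disjI1[OF refl]] sc[OF disjI2[OF refl]] .
  \<comment> \<open>Only the remainders on the two pieces along the diagonal are tracked. On the
    other two pieces the remainder energy is nonnegative and is dropped in \<open>E3\<close> and
    \<open>E4\<close>.\<close>
  define R1 R2 where "R1 = ref_int (\<lambda>z. equi_form (?G 0 0 (1/2) z - interp_grad ?V1))"
    and "R2 = ref_int (\<lambda>z. equi_form (?G (1/2) (1/2) (1/2) z - interp_grad ?V2))"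
  have R: "0 \<le> R1" "0 \<le> R2" unfolding R1_def R2_def by (simp_all add: equi_form_nonneg)
  have E1: "?E (?G 0 0 (1/2)) = R1 + 2 * ((\<alpha> - \<beta>)\<^sup>2 + (a - \<alpha>)\<^sup>2 + (a - \<beta>)\<^sup>2)"
    using energy_interp[OF V1] unfolding R1_def defs .
  have E2: "?E (?G (1/2) (1/2) (1/2)) = R2 + 2 * ((- \<alpha> - b)\<^sup>2 + (\<gamma> + \<alpha>)\<^sup>2 + (\<gamma> - b)\<^sup>2)"
    using energy_interp[OF V2] unfolding R2_def e2 unfolding defs by simp
  have E3: "?E (?G 0 (1/2) (1/2)) \<ge> 2 * ((c + \<beta>)\<^sup>2 + (- \<gamma> - c)\<^sup>2 + (\<beta> - \<gamma>)\<^sup>2)"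
  proof -
    have "0 \<le> ref_int (\<lambda>z. equi_form (?G 0 (1/2) (1/2) z - interp_grad ?V3))"
      by (simp add: equi_form_nonneg)
    then show ?thesis
      using energy_interp[OF V3] unfolding e3 e3' c_def[symmetric] by simp
  qed
  have E4: "?E (?G (1/2) 1 (-(1/2))) \<ge> 2 * ((c - b)\<^sup>2 + (a - c)\<^sup>2 + (a - b)\<^sup>2)"
  proof -
    have "0 \<le> ref_int (\<lambda>z. equi_form (?G (1/2) 1 (-(1/2)) z - interp_grad ?V4))"
      by (simp add: equi_form_nonneg)
    then show ?thesis
      using energy_interp[OF V4] unfolding e4 by simp
  qed
  have "unit_int (\<lambda>t. (V (vector [t, t]))\<^sup>2)
      = (unit_int (\<lambda>t. (?V1 (vector [t, t]))\<^sup>2) + unit_int (\<lambda>t. (?V2 (vector [t, t]))\<^sup>2)) / 2"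
    using unit_int_halves[OF continuous_on_power[OF cV[OF continuous_on_id continuous_on_id], of 2]] by simp
  also have "\<dots> \<le> ((\<alpha>\<^sup>2 + 4/3 * (a - \<beta>)\<^sup>2 + 4/3 * \<Gamma> * R1) + (\<alpha>\<^sup>2 + 4/3 * (\<gamma> - b)\<^sup>2 + 4/3 * \<Gamma> * R2)) / 2"
  proof -
    have "unit_int (\<lambda>t. (?V1 (vector [t, t]))\<^sup>2) \<le> \<alpha>\<^sup>2 + 4/3 * (a - \<beta>)\<^sup>2 + 4/3 * \<Gamma> * R1"
      using trace_bound_imp_le[OF P V1] unfolding R1_def defs .
    moreover have "unit_int (\<lambda>t. (?V2 (vector [t, t]))\<^sup>2) \<le> (- \<alpha>)\<^sup>2 + 4/3 * (\<gamma> - b)\<^sup>2 + 4/3 * \<Gamma> * R2"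
      using trace_bound_imp_le[OF P V2] unfolding R2_def e2 unfolding defs .
    ultimately show ?thesis by simp
  qed
  also have "\<dots> = \<alpha>\<^sup>2 + 2/3 * ((a - \<beta>)\<^sup>2 + (\<gamma> - b)\<^sup>2) + (2/3 * \<Gamma>) * (R1 + R2)"
    by (simp add: algebra_simps)
  also have "\<dots> \<le> 2/9 * (?E G - (R1 + R2)) + \<Delta> * (R1 + R2)"
  proof (rule add_mono)
    \<comment> \<open>The factor \<open>4/9\<close> of the quadratic form is \<open>2/9\<close>
      times the factor 2 in \<open>energy_interp\<close>; what is left of the energy after removing
      \<open>R1\<close> and \<open>R2\<close> pays for it.\<close>
    have "l \<le> 2/9 * (e - (R1 + R2))"
      if "l \<le> 4/9 * (s1 + s2 + s3 + s4)" "e1 + e2 + e3 + e4 \<le> e" "e1 = R1 + 2 * s1" "e2 = R2 + 2 * s2"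
        "2 * s3 \<le> e3" "2 * s4 \<le> e4" for l e e1 e2 e3 e4 s1 s2 s3 s4 :: real
      using that by (simp add: field_simps)
    from this[OF subdivision_form_le E E1 E2 E3 E4]
    show "\<alpha>\<^sup>2 + 2/3 * ((a - \<beta>)\<^sup>2 + (\<gamma> - b)\<^sup>2) \<le> 2/9 * (?E G - (R1 + R2))" .
    show "(2/3 * \<Gamma>) * (R1 + R2) \<le> \<Delta> * (R1 + R2)"
      using \<Delta> R by (intro mult_right_mono) auto
  qed
  also have "\<dots> \<le> \<Delta> * (?E G - (R1 + R2)) + \<Delta> * (R1 + R2)"
  proof -
    have "0 \<le> ?E (?G 0 (1/2) (1/2))" "0 \<le> ?E (?G (1/2) 1 (-(1/2)))"
      by (simp_all add: equi_form_nonneg)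
    moreover have "R1 \<le> ?E (?G 0 0 (1/2))" "R2 \<le> ?E (?G (1/2) (1/2) (1/2))"
      unfolding E1 E2 by simp_all
    ultimately have "0 \<le> ?E G - (R1 + R2)" using E by linarith
    then show ?thesis using \<Delta>(1) by (intro add_right_mono mult_right_mono) auto
  qed
  also have "\<dots> = \<Delta> * ?E G" by (simp add: algebra_simps)
  finally show "unit_int (\<lambda>t. (V (vector [t, t]))\<^sup>2) \<le> \<Delta> * ?E G" .
qed

lemma trace_bound_two_ninths: "trace_bound (2/9)"
proof -
  have "trace_bound 2"
    unfolding trace_bound_def
  proof (intro allI impI)
    fix V G assume V: "C1_grad V G" and m: "diag_mean V = 0"
    have "unit_int (\<lambda>t. (V (vector [t, t]))\<^sup>2) \<le> 2 * ref_int (\<lambda>z. (G z $ 1)\<^sup>2 + (G z $ 2)\<^sup>2)"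
      by (rule trace_sq_le[OF V m])
    also have "\<dots> \<le> 2 * ref_int (\<lambda>z. equi_form (G z))"
      by (intro mult_left_mono integral_mono integrable_ref_tri continuous_intros C1_grad_continuous[OF V])
        (auto simp: equi_form_def)
    finally show "unit_int (\<lambda>t. (V (vector [t, t]))\<^sup>2) \<le> 2 * ref_int (\<lambda>z. equi_form (G z))" .
  qed
  \<comment> \<open>Each constant is at least \<open>2/3\<close> of the previous one. From
    \<open>4/10\<close> on the values are rounded up, and \<open>2/3 * 3/10 = 1/5\<close> finally
    lies below the floor \<open>2/9\<close> of the step.\<close>
  then have "trace_bound (4/3)" by (rule trace_bound_step) auto
  then have "trace_bound (8/9)" by (rule trace_bound_step) auto
  then have "trace_bound (16/27)" by (rule trace_bound_step) auto
  then have "trace_bound (4/10)" by (rule trace_bound_step) auto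
  then have "trace_bound (3/10)" by (rule trace_bound_step) auto
  then show ?thesis by (rule trace_bound_step) auto
qed

section \<open>Transfer to an arbitrary triangle\<close>

text \<open>This expresses a boundary mean by integrals over the triangle, which makes it continuous in
  the \<open>H\<^sup>1\<close> norm.\<close>

lemma diag_mean_eq_ref_int:
  assumes V: "C1_grad V G"
  shows "diag_mean V = ref_int (\<lambda>z. 2 * V z + z $ 1 * G z $ 1 - (1 - z $ 2) * G z $ 2)"
proof -
  note c = C1_grad_continuous[OF V]
  have i: "integrable (lebesgue_on {0..1}) (\<lambda>t. V (vector [t, t]))"
      "integrable (lebesgue_on {0..1}) (\<lambda>t. t * V (vector [t, t]))"
    by (intro integrable_unit continuous_intros compose_vector2_continuous c)+
  \<comment> \<open>Multiplying \<open>V\<close> by \<open>x\<close> removes the left edge and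
    multiplying by \<open>1 - y\<close> removes the top edge. On the diagonal the weights
    \<open>t\<close> and \<open>1 - t\<close> add up to one.\<close>
  have "ref_int (\<lambda>z. V z + z $ 1 * G z $ 1) = unit_int (\<lambda>t. t * V (vector [t, t]))"
    using ref_int_grad_x[OF C1_grad_mult[OF C1_grad_affine[of 0 "axis 1 1"] V]]
    by (simp add: inner_vec2 axis_def add.commute)
  moreover have "ref_int (\<lambda>z. - V z + (1 - z $ 2) * G z $ 2) = - unit_int (\<lambda>t. (1 - t) * V (vector [t, t]))"
    using ref_int_grad_y[OF C1_grad_mult[OF C1_grad_affine[of 1 "- axis 2 1"] V]]
    by (simp add: inner_vec2 axis_def add.commute)
  ultimately have "diag_mean V = ref_int (\<lambda>z. V z + z $ 1 * G z $ 1) - ref_int (\<lambda>z. - V z + (1 - z $ 2) * G z $ 2)"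
    using i by (simp add: left_diff_distrib)
  also have "\<dots> = ref_int (\<lambda>z. (V z + z $ 1 * G z $ 1) - (- V z + (1 - z $ 2) * G z $ 2))"
    by (intro Bochner_Integration.integral_diff[symmetric] integrable_ref_tri continuous_intros c)
  finally show ?thesis by (simp add: algebra_simps)
qed

lemma sq_ref_int_le:
  assumes "continuous_on UNIV F"
  shows "(ref_int F)\<^sup>2 \<le> ref_int (\<lambda>z. (F z)\<^sup>2)"
proof (rule sq_integral_le)
  show "finite_measure (lebesgue_on ref_tri)"
    by (rule finite_measure_lebesgue_on) (rule lmeasurable_compact[OF compact_ref_tri])
qed (auto intro!: integrable_ref_tri continuous_intros assms)

text \<open>The diagonal mean costs the factor 12. The other two means differ from it by the
  integral of one partial derivative, which gives \<open>2 * 12 + 2 = 26\<close>.\<close>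

lemma edge_means_sq_le:
  assumes V: "C1_grad V G"
  defines "N \<equiv> ref_int (\<lambda>z. (V z)\<^sup>2 + (G z $ 1)\<^sup>2 + (G z $ 2)\<^sup>2)"
  shows "(diag_mean V)\<^sup>2 \<le> 26 * N" "(left_mean V)\<^sup>2 \<le> 26 * N" "(top_mean V)\<^sup>2 \<le> 26 * N"
proof -
  note c = C1_grad_continuous[OF V]
  have two: "(x + y)\<^sup>2 \<le> 2 * x\<^sup>2 + 2 * y\<^sup>2" for x y :: real
    using zero_le_power2[of "x - y"] by (simp add: power2_eq_square algebra_simps)
  have "(diag_mean V)\<^sup>2 \<le> ref_int (\<lambda>z. (2 * V z + z $ 1 * G z $ 1 - (1 - z $ 2) * G z $ 2)\<^sup>2)"
    unfolding diag_mean_eq_ref_int[OF V] by (intro sq_ref_int_le continuous_intros c)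
  also have "\<dots> \<le> ref_int (\<lambda>z. 12 * ((V z)\<^sup>2 + (G z $ 1)\<^sup>2 + (G z $ 2)\<^sup>2))"
  proof (intro integral_mono integrable_ref_tri continuous_intros c)
    fix z assume "z \<in> space (lebesgue_on ref_tri)"
    then have z: "0 \<le> z $ 1" "z $ 1 \<le> 1" "0 \<le> z $ 2" "z $ 2 \<le> 1" by (auto simp: ref_tri_def)
    have "(z $ 1 * G z $ 1)\<^sup>2 \<le> (1 * G z $ 1)\<^sup>2" "((1 - z $ 2) * G z $ 2)\<^sup>2 \<le> (1 * G z $ 2)\<^sup>2"
      unfolding power_mult_distrib by (intro mult_right_mono power_mono; use z in simp)+
    \<comment> \<open>Cauchy-Schwarz for a sum of three terms.\<close>
    moreover have "(2 * x + y - w)\<^sup>2 \<le> 12 * x\<^sup>2 + 3 * y\<^sup>2 + 3 * w\<^sup>2" for x y w :: real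
    proof -
      have "12 * x\<^sup>2 + 3 * y\<^sup>2 + 3 * w\<^sup>2 - (2 * x + y - w)\<^sup>2 = (2 * x - y)\<^sup>2 + (2 * x + w)\<^sup>2 + (y + w)\<^sup>2"
        by (simp add: power2_eq_square algebra_simps)
      then show ?thesis by (smt (verit) zero_le_power2)
    qed
    from this[of "V z" "z $ 1 * G z $ 1" "(1 - z $ 2) * G z $ 2"]
    have "(2 * V z + z $ 1 * G z $ 1 - (1 - z $ 2) * G z $ 2)\<^sup>2
      \<le> 12 * (V z)\<^sup>2 + 3 * (z $ 1 * G z $ 1)\<^sup>2 + 3 * ((1 - z $ 2) * G z $ 2)\<^sup>2" .
    ultimately show "(2 * V z + z $ 1 * G z $ 1 - (1 - z $ 2) * G z $ 2)\<^sup>2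
        \<le> 12 * ((V z)\<^sup>2 + (G z $ 1)\<^sup>2 + (G z $ 2)\<^sup>2)"
      using zero_le_power2[of "G z $ 1"] zero_le_power2[of "G z $ 2"]
      unfolding distrib_left mult_1 by linarith
  qed
  also have "\<dots> = 12 * N" unfolding N_def by (rule integral_mult_right_zero)
  finally have d: "(diag_mean V)\<^sup>2 \<le> 12 * N" .
  have x: "(ref_int (\<lambda>z. G z $ 1))\<^sup>2 \<le> N" and y: "(ref_int (\<lambda>z. G z $ 2))\<^sup>2 \<le> N"
    unfolding N_def by (rule order_trans[OF sq_ref_int_le], intro c,
        intro integral_mono integrable_ref_tri continuous_intros c, simp)+
  have "0 \<le> N" using x zero_le_power2 order_trans by blast
  with d show "(diag_mean V)\<^sup>2 \<le> 26 * N" by simp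
  show "(left_mean V)\<^sup>2 \<le> 26 * N"
    using two[of "diag_mean V" "- ref_int (\<lambda>z. G z $ 1)"] ref_int_grad_x[OF V] d x
    by (simp add: power2_commute[of "left_mean V" "diag_mean V"])
  show "(top_mean V)\<^sup>2 \<le> 26 * N"
    using two[of "diag_mean V" "ref_int (\<lambda>z. G z $ 2)"] ref_int_grad_y[OF V] d y by simp
qed

text \<open>The edge vectors of a triangle sum to zero, so the three squares in
  \<open>equi_form\<close> are squared derivatives along the edges. By Cauchy-Schwarz each
  derivative is at most \<open>h * norm w\<close> in modulus.\<close>

lemma equi_form_edges_le:
  fixes P1 P2 P3 w :: "real^2"
  assumes "dist P1 P2 \<le> h" "dist P2 P3 \<le> h" "dist P3 P1 \<le> h"
  shows "equi_form (vector [(P2 - P3) \<bullet> w, (P3 - P1) \<bullet> w]) \<le> 2 * h\<^sup>2 * (norm w)\<^sup>2"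
proof -
  define x y where "x = (P2 - P3) \<bullet> w" and "y = (P3 - P1) \<bullet> w"
  have le: "\<bar>x\<bar> \<le> h * norm w" "\<bar>y\<bar> \<le> h * norm w" "\<bar>x + y\<bar> \<le> h * norm w"
  proof -
    have cs: "\<bar>p \<bullet> w\<bar> \<le> h * norm w" if "norm p \<le> h" for p :: "real^2"
      using that by (meson Cauchy_Schwarz_ineq2 mult_right_mono norm_ge_zero order_trans)
    show "\<bar>x\<bar> \<le> h * norm w" "\<bar>y\<bar> \<le> h * norm w"
      unfolding x_def y_def using assms by (auto intro!: cs simp: dist_norm)
    have "x + y = (P2 - P1) \<bullet> w" by (simp add: x_def y_def inner_diff_left)
    then show "\<bar>x + y\<bar> \<le> h * norm w"
      using assms by (auto intro!: cs simp: dist_norm norm_minus_commute)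
  qed
  have sq: "x\<^sup>2 \<le> (h * norm w)\<^sup>2" "y\<^sup>2 \<le> (h * norm w)\<^sup>2" "(x + y)\<^sup>2 \<le> (h * norm w)\<^sup>2"
    using le by (auto simp: abs_le_square_iff[symmetric] intro: order_trans[OF _ abs_ge_self])
  have "x\<^sup>2 + y\<^sup>2 + (x + y)\<^sup>2 \<le> 2 * (h * norm w)\<^sup>2"
  proof -
    \<comment> \<open>Of the numbers \<open>x\<close>, \<open>y\<close>, \<open>- (x + y)\<close> with sum zero, two have the same sign, and
      their squares add up to at most the square of the third.\<close>
    consider "0 \<le> x * y" | "x * y \<le> 0" "x * (x + y) \<le> 0" | "x * y \<le> 0" "y * (x + y) \<le> 0"
    proof -
      have "x * (x + y) \<le> 0 \<or> y * (x + y) \<le> 0" if "x * y < 0"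
        using that by (smt (verit) mult_less_0_iff mult_le_0_iff)
      then show ?thesis using that by linarith
    qed
    then show ?thesis
    proof cases
      case 1
      then show ?thesis using sq by (simp add: power2_sum)
    next
      case 2
      then have "x\<^sup>2 + (x + y)\<^sup>2 \<le> y\<^sup>2" by (simp add: power2_eq_square algebra_simps)
      then show ?thesis using sq by linarith
    next
      case 3
      then have "y\<^sup>2 + (x + y)\<^sup>2 \<le> x\<^sup>2" by (simp add: power2_eq_square algebra_simps)
      then show ?thesis using sq by linarith
    qed
  qed
  then show ?thesis
    by (simp add: equi_form_def x_def y_def power_mult_distrib)
qed

section \<open>The affine map onto a triangle\<close>

text \<open>It sends \<open>(0,0)\<close>, \<open>(1,1)\<close>, \<open>(0,1)\<close> to
  \<open>P1\<close>, \<open>P2\<close>, \<open>P3\<close>, and the two coordinate derivatives become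
  derivatives along \<open>P2 - P3\<close> and \<open>P3 - P1\<close>.\<close>

definition tri_map :: "real^2 \<Rightarrow> real^2 \<Rightarrow> real^2 \<Rightarrow> real^2 \<Rightarrow> real^2" where
  "tri_map P1 P2 P3 z = P1 + z $ 1 *\<^sub>R (P2 - P3) + z $ 2 *\<^sub>R (P3 - P1)"

text \<open>The absolute Jacobian of \<open>tri_map\<close>, which is twice the area of the
  triangle.\<close>

definition tri_det :: "real^2 \<Rightarrow> real^2 \<Rightarrow> real^2 \<Rightarrow> real" where
  "tri_det P1 P2 P3 = \<bar>(P2 - P3) $ 1 * (P3 - P1) $ 2 - (P2 - P3) $ 2 * (P3 - P1) $ 1\<bar>"

lemma tri_det_pos:
  assumes "\<not> collinear {P1, P2, P3}"
  shows "0 < tri_det P1 P2 P3"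
proof (rule ccontr)
  assume "\<not> 0 < tri_det P1 P2 P3"
  then have z: "(P2 - P3) $ 1 * (P3 - P1) $ 2 = (P2 - P3) $ 2 * (P3 - P1) $ 1"
    by (simp add: tri_det_def)
  \<comment> \<open>By Lagrange's identity a vanishing determinant is the equality case of
    Cauchy-Schwarz, which characterises collinearity.\<close>
  have "((P2 - P3) \<bullet> (P3 - P1))\<^sup>2 = ((P2 - P3) \<bullet> (P2 - P3)) * ((P3 - P1) \<bullet> (P3 - P1))"
  proof -
    have "(x1 * y1 + x2 * y2)\<^sup>2 = (x1 * x1 + x2 * x2) * (y1 * y1 + y2 * y2)"
      if "x1 * y2 = x2 * y1" for x1 x2 y1 y2 :: real
      using that by algebra
    from this[OF z] show ?thesis unfolding inner_vec2 .
  qed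
  then have "\<bar>(P2 - P3) \<bullet> (P3 - P1)\<bar> = norm (P2 - P3) * norm (P3 - P1)"
    by (metis norm_eq_sqrt_inner real_sqrt_abs real_sqrt_mult)
  then have "\<bar>(P2 - P3) \<bullet> (P1 - P3)\<bar> = norm (P2 - P3) * norm (P1 - P3)"
    by (metis abs_minus_cancel inner_minus_right minus_diff_eq norm_minus_commute)
  then have "collinear {0, P2 - P3, P1 - P3}"
    by (simp add: norm_cauchy_schwarz_equal)
  then have "collinear {P2, P3, P1}"
    using collinear_3[of P2 P3 P1] by simp
  with assms show False by (simp add: insert_commute)
qed

lemma tri_map_image: "tri_map P1 P2 P3 ` ref_tri = convex hull {P1, P2, P3}"
proof (intro equalityI subsetI)
  fix p assume "p \<in> tri_map P1 P2 P3 ` ref_tri"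
  then obtain z where z: "z \<in> ref_tri" "p = tri_map P1 P2 P3 z" by blast
  \<comment> \<open>The barycentric coordinates are \<open>1 - z $ 2\<close>, \<open>z $ 1\<close>
    and \<open>z $ 2 - z $ 1\<close>.\<close>
  have "p = (1 - z $ 2) *\<^sub>R P1 + z $ 1 *\<^sub>R P2 + (z $ 2 - z $ 1) *\<^sub>R P3"
    by (simp add: z tri_map_def algebra_simps)
  moreover have "0 \<le> 1 - z $ 2" "0 \<le> z $ 1" "0 \<le> z $ 2 - z $ 1" "1 - z $ 2 + z $ 1 + (z $ 2 - z $ 1) = 1"
    using z by (auto simp: ref_tri_def)
  ultimately show "p \<in> convex hull {P1, P2, P3}"
    unfolding convex_hull_3 by blast
next
  fix p assume "p \<in> convex hull {P1, P2, P3}"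
  then obtain u v w where uvw: "0 \<le> u" "0 \<le> v" "0 \<le> w" "u + v + w = 1" "p = u *\<^sub>R P1 + v *\<^sub>R P2 + w *\<^sub>R P3"
    unfolding convex_hull_3 by blast
  then have u: "u = 1 - (v + w)" by simp
  have "p = tri_map P1 P2 P3 (vector [v, v + w])"
    unfolding uvw(5) u by (simp add: tri_map_def algebra_simps)
  moreover have "vector [v, v + w] \<in> ref_tri"
    using uvw by (simp add: ref_tri_def)
  ultimately show "p \<in> tri_map P1 P2 P3 ` ref_tri" by blast
qed

lemma integral_tri_map:
  assumes tri: "\<not> collinear {P1, P2, P3}" and K: "K = convex hull {P1, P2, P3}"
    and F: "integrable (lebesgue_on K) F"
  shows "integral\<^sup>L (lebesgue_on K) F = tri_det P1 P2 P3 * ref_int (\<lambda>z. F (tri_map P1 P2 P3 z))"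
proof -
  have d: "(P2 - P3) $ 1 * (P3 - P1) $ 2 - (P2 - P3) $ 2 * (P3 - P1) $ 1 \<noteq> 0"
    using tri_det_pos[OF tri] unfolding tri_det_def by simp
  have F': "integrable (lebesgue_on ((\<lambda>z. P1 + z $ 1 *\<^sub>R (P2 - P3) + z $ 2 *\<^sub>R (P3 - P1)) ` ref_tri)) F"
    using F unfolding K tri_map_image[symmetric] tri_map_def .
  show "integral\<^sup>L (lebesgue_on K) F = tri_det P1 P2 P3 * ref_int (\<lambda>z. F (tri_map P1 P2 P3 z))"
    using integral_affine_image[OF d compact_ref_tri F']
    unfolding K tri_map_image[symmetric] tri_map_def tri_det_def .
qed

lemma seg_param_tri_map:
  "seg_param P1 P2 t = tri_map P1 P2 P3 (vector [t, t])"
  "seg_param P2 P3 t = tri_map P1 P2 P3 (vector [1 - t, 1])"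
  "seg_param P3 P1 t = tri_map P1 P2 P3 (vector [0, 1 - t])"
  by (simp_all add: seg_param_def tri_map_def algebra_simps)

lemma continuous_on_seg_param [continuous_intros]: "continuous_on S (seg_param A B)"
  unfolding seg_param_def by (intro continuous_intros)

lemma C1_grad_tri_map:
  "C1_grad v G \<Longrightarrow> C1_grad (\<lambda>z. v (tri_map P1 P2 P3 z))
     (\<lambda>z. vector [(P2 - P3) \<bullet> G (tri_map P1 P2 P3 z), (P3 - P1) \<bullet> G (tri_map P1 P2 P3 z)])"
  unfolding tri_map_def by (rule C1_grad_compose_affine)

text \<open>Going around the triangle cyclically reverses the top and left edges of the reference
  triangle; reflecting the parameter does not change their means.\<close>

lemma edge_means_tri_map:
  assumes v: "C1_grad v G"
  shows "diag_mean (\<lambda>z. v (tri_map P1 P2 P3 z)) = unit_int (\<lambda>t. v (seg_param P1 P2 t))"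
    and "top_mean (\<lambda>z. v (tri_map P1 P2 P3 z)) = unit_int (\<lambda>t. v (seg_param P2 P3 t))"
    and "left_mean (\<lambda>z. v (tri_map P1 P2 P3 z)) = unit_int (\<lambda>t. v (seg_param P3 P1 t))"
proof -
  have c: "continuous_on UNIV (\<lambda>t. v (tri_map P1 P2 P3 (vector [f t, g t])))"
    if "continuous_on UNIV f" "continuous_on UNIV g" for f g :: "real \<Rightarrow> real"
    using that by (intro compose_vector2_continuous[of "\<lambda>z. v (tri_map P1 P2 P3 z)"]
        C1_grad_continuous(1)[OF C1_grad_tri_map[OF v]])
  show "diag_mean (\<lambda>z. v (tri_map P1 P2 P3 z)) = unit_int (\<lambda>t. v (seg_param P1 P2 t))"
    by (simp add: seg_param_tri_map(1)[of P1 P2 _ P3])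
  show "top_mean (\<lambda>z. v (tri_map P1 P2 P3 z)) = unit_int (\<lambda>t. v (seg_param P2 P3 t))"
    using unit_int_reflect[OF c[of "\<lambda>t. t" "\<lambda>_. 1"]]
    by (simp add: seg_param_tri_map(2)[of P2 P3 _ P1] continuous_intros)
  show "left_mean (\<lambda>z. v (tri_map P1 P2 P3 z)) = unit_int (\<lambda>t. v (seg_param P3 P1 t))"
    using unit_int_reflect[OF c[of "\<lambda>_. 0" "\<lambda>t. t"]]
    by (simp add: seg_param_tri_map(3)[of P3 P1 _ P2] continuous_intros)
qed

lemma compact_triangle: "compact (convex hull {P1, P2, P3 :: real^2})"
  by (simp add: finite_imp_compact_convex_hull)

text \<open>The constant is \<open>2/9\<close> from the reference inequality times 2 from
  \<open>equi_form_edges_le\<close>. The vector \<open>b\<close> is arbitrary because in the limit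
  it is the interpolation gradient of \<open>u\<close>, not that of the approximating
  function.\<close>

lemma edge_trace_bound_C1:
  assumes tri: "\<not> collinear {P1, P2, P3}" and K: "K = convex hull {P1, P2, P3}"
    and h: "dist P1 P2 \<le> h" "dist P2 P3 \<le> h" "dist P3 P1 \<le> h"
    and v: "C1_grad v G"
  shows "unit_int (\<lambda>t. (v (seg_param P1 P2 t) - (unit_int (\<lambda>t. v (seg_param P1 P2 t))
        + 2 * (unit_int (\<lambda>t. v (seg_param P2 P3 t)) - unit_int (\<lambda>t. v (seg_param P3 P1 t))) * (t - 1/2)))\<^sup>2)
    \<le> 4/9 * h\<^sup>2 / tri_det P1 P2 P3 * integral\<^sup>L (lebesgue_on K) (\<lambda>x. (norm (G x - b))\<^sup>2)" (is "?l \<le> _")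
proof -
  let ?f = "tri_map P1 P2 P3"
  let ?V = "\<lambda>z. v (?f z)" and ?G = "\<lambda>z. vector [(P2 - P3) \<bullet> G (?f z), (P3 - P1) \<bullet> G (?f z)] :: real^2"
  let ?b = "vector [(P2 - P3) \<bullet> b, (P3 - P1) \<bullet> b] :: real^2"
  have V: "C1_grad ?V ?G" by (rule C1_grad_tri_map[OF v])
  have cf: "continuous_on UNIV ?f" unfolding tri_map_def by (intro continuous_intros)
  have cG: "continuous_on UNIV (\<lambda>z. G (?f z))"
    by (rule continuous_on_compose2[OF C1_grad_continuous(2)[OF v] cf]) auto
  have "?l \<le> 2/9 * ref_int (\<lambda>z. equi_form (?G z - interp_grad ?V))"
    using trace_bound_interp[OF trace_bound_two_ninths V]
    unfolding edge_means_tri_map[OF v] unfolding seg_param_tri_map(1)[of P1 P2 _ P3] .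
  \<comment> \<open>By \<open>energy_split\<close>, replacing the interpolation gradient by another
    constant can only increase the energy.\<close>
  also have "\<dots> \<le> 2/9 * ref_int (\<lambda>z. equi_form (?G z - ?b))"
    using energy_split[OF V, of ?b] equi_form_nonneg[of "interp_grad ?V - ?b"] by simp
  also have "\<dots> \<le> 2/9 * ref_int (\<lambda>z. 2 * h\<^sup>2 * (norm (G (?f z) - b))\<^sup>2)"
  proof (intro mult_left_mono integral_mono integrable_ref_tri continuous_intros cG)
    fix z
    have "?G z - ?b = vector [(P2 - P3) \<bullet> (G (?f z) - b), (P3 - P1) \<bullet> (G (?f z) - b)]"
      by (simp add: vec2_eq_iff inner_diff_right)
    then show "equi_form (?G z - ?b) \<le> 2 * h\<^sup>2 * (norm (G (?f z) - b))\<^sup>2"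
      using equi_form_edges_le[OF h] by simp
  qed simp
  also have "\<dots> = 4/9 * h\<^sup>2 * ref_int (\<lambda>z. (norm (G (?f z) - b))\<^sup>2)"
    by simp
  also have "ref_int (\<lambda>z. (norm (G (?f z) - b))\<^sup>2)
      = integral\<^sup>L (lebesgue_on K) (\<lambda>x. (norm (G x - b))\<^sup>2) / tri_det P1 P2 P3"
    using integral_tri_map[OF tri K, of "\<lambda>x. (norm (G x - b))\<^sup>2"] tri_det_pos[OF tri]
      integrable_lebesgue_on_compact[of K "\<lambda>x. (norm (G x - b))\<^sup>2"] compact_triangle K
    by (simp add: continuous_intros C1_grad_continuous[OF v])
  finally show ?thesis by simp
qed

text \<open>A qualitative bound, used only to show that edge means converge; its constant does not
  enter the final estimate.\<close>

lemma edge_means_bound_C1: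
  assumes tri: "\<not> collinear {P1, P2, P3}" and K: "K = convex hull {P1, P2, P3}"
  obtains C where
    "\<And>v G. C1_grad v G \<Longrightarrow> (unit_int (\<lambda>t. v (seg_param P1 P2 t)))\<^sup>2 \<le> C * integral\<^sup>L (lebesgue_on K) (\<lambda>x. (v x)\<^sup>2 + (norm (G x))\<^sup>2)"
    "\<And>v G. C1_grad v G \<Longrightarrow> (unit_int (\<lambda>t. v (seg_param P2 P3 t)))\<^sup>2 \<le> C * integral\<^sup>L (lebesgue_on K) (\<lambda>x. (v x)\<^sup>2 + (norm (G x))\<^sup>2)"
    "\<And>v G. C1_grad v G \<Longrightarrow> (unit_int (\<lambda>t. v (seg_param P3 P1 t)))\<^sup>2 \<le> C * integral\<^sup>L (lebesgue_on K) (\<lambda>x. (v x)\<^sup>2 + (norm (G x))\<^sup>2)"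
proof -
  \<comment> \<open>The perimeter is a convenient common bound for the three edge lengths.\<close>
  define h where "h = dist P1 P2 + dist P2 P3 + dist P3 P1"
  have h: "dist P1 P2 \<le> h" "dist P2 P3 \<le> h" "dist P3 P1 \<le> h" by (auto simp: h_def)
  define C where "C = 26 * (1 + 2 * h\<^sup>2) / tri_det P1 P2 P3"
  let ?f = "tri_map P1 P2 P3"
  have main: "26 * ref_int (\<lambda>z. (v (?f z))\<^sup>2 + ((P2 - P3) \<bullet> G (?f z))\<^sup>2 + ((P3 - P1) \<bullet> G (?f z))\<^sup>2)
     \<le> C * integral\<^sup>L (lebesgue_on K) (\<lambda>x. (v x)\<^sup>2 + (norm (G x))\<^sup>2)" if v: "C1_grad v G" for v G
  proof -
    have cf: "continuous_on UNIV ?f" unfolding tri_map_def by (intro continuous_intros)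
    have cG: "continuous_on UNIV (\<lambda>z. G (?f z))" and cv: "continuous_on UNIV (\<lambda>z. v (?f z))"
      by (rule continuous_on_compose2[OF C1_grad_continuous(2)[OF v] cf]
          continuous_on_compose2[OF C1_grad_continuous(1)[OF v] cf], auto)+
    have "ref_int (\<lambda>z. (v (?f z))\<^sup>2 + ((P2 - P3) \<bullet> G (?f z))\<^sup>2 + ((P3 - P1) \<bullet> G (?f z))\<^sup>2)
       \<le> ref_int (\<lambda>z. (1 + 2 * h\<^sup>2) * ((v (?f z))\<^sup>2 + (norm (G (?f z)))\<^sup>2))"
    proof (intro integral_mono integrable_ref_tri continuous_intros cG cv)
      fix z
      have "((P2 - P3) \<bullet> G (?f z))\<^sup>2 + ((P3 - P1) \<bullet> G (?f z))\<^sup>2 \<le> 2 * h\<^sup>2 * (norm (G (?f z)))\<^sup>2"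
        using equi_form_edges_le[OF h, of "G (?f z)"]
          zero_le_power2[of "(P2 - P3) \<bullet> G (?f z) + (P3 - P1) \<bullet> G (?f z)"]
        unfolding equi_form_def vector_2 by linarith
      moreover have "0 \<le> 2 * h\<^sup>2 * (v (?f z))\<^sup>2" "0 \<le> (norm (G (?f z)))\<^sup>2" by simp_all
      ultimately show "(v (?f z))\<^sup>2 + ((P2 - P3) \<bullet> G (?f z))\<^sup>2 + ((P3 - P1) \<bullet> G (?f z))\<^sup>2
         \<le> (1 + 2 * h\<^sup>2) * ((v (?f z))\<^sup>2 + (norm (G (?f z)))\<^sup>2)"
        unfolding distrib_left distrib_right mult_1 by linarith
    qed
    also have "\<dots> = (1 + 2 * h\<^sup>2) * (integral\<^sup>L (lebesgue_on K) (\<lambda>x. (v x)\<^sup>2 + (norm (G x))\<^sup>2) / tri_det P1 P2 P3)"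
      using integral_tri_map[OF tri K, of "\<lambda>x. (v x)\<^sup>2 + (norm (G x))\<^sup>2"] tri_det_pos[OF tri]
        integrable_lebesgue_on_compact[of K "\<lambda>x. (v x)\<^sup>2 + (norm (G x))\<^sup>2"] compact_triangle K
      by (simp add: continuous_intros C1_grad_continuous[OF v])
    finally have "26 * ref_int (\<lambda>z. (v (?f z))\<^sup>2 + ((P2 - P3) \<bullet> G (?f z))\<^sup>2 + ((P3 - P1) \<bullet> G (?f z))\<^sup>2)
       \<le> 26 * ((1 + 2 * h\<^sup>2) * (integral\<^sup>L (lebesgue_on K) (\<lambda>x. (v x)\<^sup>2 + (norm (G x))\<^sup>2) / tri_det P1 P2 P3))"
      by (rule mult_left_mono) simp
    then show ?thesis
      by (simp only: C_def times_divide_eq_right times_divide_eq_left mult.assoc)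
  qed
  note m = edge_means_sq_le[OF C1_grad_tri_map, of _ _ P1 P2 P3, unfolded vector_2]
  show ?thesis
  proof (rule that[of C])
    fix v G assume v: "C1_grad v G"
    show "(unit_int (\<lambda>t. v (seg_param P1 P2 t)))\<^sup>2 \<le> C * integral\<^sup>L (lebesgue_on K) (\<lambda>x. (v x)\<^sup>2 + (norm (G x))\<^sup>2)"
      using order_trans[OF m(1)[OF v] main[OF v]] unfolding edge_means_tri_map[OF v] .
    show "(unit_int (\<lambda>t. v (seg_param P2 P3 t)))\<^sup>2 \<le> C * integral\<^sup>L (lebesgue_on K) (\<lambda>x. (v x)\<^sup>2 + (norm (G x))\<^sup>2)"
      using order_trans[OF m(3)[OF v] main[OF v]] unfolding edge_means_tri_map[OF v] .
    show "(unit_int (\<lambda>t. v (seg_param P3 P1 t)))\<^sup>2 \<le> C * integral\<^sup>L (lebesgue_on K) (\<lambda>x. (v x)\<^sup>2 + (norm (G x))\<^sup>2)"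
      using order_trans[OF m(2)[OF v] main[OF v]] unfolding edge_means_tri_map[OF v] .
  qed
qed

section \<open>Passage to the limit\<close>

text \<open>One notion for functions and gradients on the triangle and for traces on the parameter
  interval.\<close>

definition L2_fun :: "'a measure \<Rightarrow> ('a \<Rightarrow> 'b::euclidean_space) \<Rightarrow> bool" where
  "L2_fun M f \<longleftrightarrow> f \<in> borel_measurable M \<and> integrable M (\<lambda>x. (norm (f x))\<^sup>2)"

text \<open>Young's inequality with a parameter: a small \<open>\<epsilon>\<close> keeps the factor
  of the main term close to one, at the price of a large factor on a term that tends to
  zero.\<close>

lemma norm_add_sq_le:
  fixes x y :: "'a::real_normed_vector"
  assumes "0 < \<epsilon>"
  shows "(norm (x + y))\<^sup>2 \<le> (1 + \<epsilon>) * (norm x)\<^sup>2 + (1 + 1 / \<epsilon>) * (norm y)\<^sup>2"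
proof -
  have "(norm (x + y))\<^sup>2 \<le> (norm x + norm y)\<^sup>2"
    by (intro power_mono norm_triangle_ineq) simp
  also have "\<dots> = (1 + \<epsilon>) * (norm x)\<^sup>2 + (1 + 1 / \<epsilon>) * (norm y)\<^sup>2 - (\<epsilon> * norm x - norm y)\<^sup>2 / \<epsilon>"
    using assms by (simp add: power2_eq_square field_simps)
  also have "\<dots> \<le> (1 + \<epsilon>) * (norm x)\<^sup>2 + (1 + 1 / \<epsilon>) * (norm y)\<^sup>2"
    using assms by simp
  finally show ?thesis .
qed

lemma L2_fun_add:
  assumes "L2_fun M f" "L2_fun M g"
  shows "L2_fun M (\<lambda>x. f x + g x)"
proof -
  have [measurable]: "f \<in> borel_measurable M" "g \<in> borel_measurable M"
    using assms by (auto simp: L2_fun_def)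
  have "integrable M (\<lambda>x. (norm (f x + g x))\<^sup>2)"
  proof (rule Bochner_Integration.integrable_bound)
    show "integrable M (\<lambda>x. 2 * (norm (f x))\<^sup>2 + 2 * (norm (g x))\<^sup>2)"
      using assms by (auto simp: L2_fun_def)
    show "AE x in M. norm ((norm (f x + g x))\<^sup>2) \<le> norm (2 * (norm (f x))\<^sup>2 + 2 * (norm (g x))\<^sup>2)"
      using norm_add_sq_le[of 1] by auto
  qed simp
  then show ?thesis by (simp add: L2_fun_def)
qed

lemma L2_fun_minus: "L2_fun M f \<Longrightarrow> L2_fun M (\<lambda>x. - f x)"
  by (simp add: L2_fun_def)

lemma L2_fun_diff: "L2_fun M f \<Longrightarrow> L2_fun M g \<Longrightarrow> L2_fun M (\<lambda>x. f x - g x)"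
  using L2_fun_add[OF _ L2_fun_minus, of M f g] by simp

lemma L2_fun_integrable: "L2_fun M f \<Longrightarrow> integrable M (\<lambda>x. (norm (f x))\<^sup>2)"
  by (simp add: L2_fun_def)

lemma L2_fun_integrable_real:
  fixes f :: "'a \<Rightarrow> real"
  assumes f: "L2_fun M f" and M: "finite_measure M"
  shows "integrable M f" "integrable M (\<lambda>x. (f x)\<^sup>2)"
proof -
  interpret finite_measure M by fact
  show sq: "integrable M (\<lambda>x. (f x)\<^sup>2)" using f by (simp add: L2_fun_def)
  show "integrable M f"
  proof (rule Bochner_Integration.integrable_bound)
    show "integrable M (\<lambda>x. 1 + (f x)\<^sup>2)" using sq by simp
    have "\<bar>y\<bar> \<le> 1 + y\<^sup>2" for y :: real
      using zero_le_power2[of "\<bar>y\<bar> - 1"] by (simp add: power2_diff)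
    then show "AE x in M. norm (f x) \<le> norm (1 + (f x)\<^sup>2)" by auto
  qed (use f in \<open>simp add: L2_fun_def\<close>)
qed

lemma L2_fun_continuous:
  fixes f :: "'a::euclidean_space \<Rightarrow> 'b::euclidean_space"
  assumes "compact S" "continuous_on S f"
  shows "L2_fun (lebesgue_on S) f"
  unfolding L2_fun_def
proof
  show "f \<in> borel_measurable (lebesgue_on S)"
    using assms by (intro continuous_imp_measurable_on_sets_lebesgue) (auto simp: compact_imp_closed)
  show "integrable (lebesgue_on S) (\<lambda>x. (norm (f x))\<^sup>2)"
    using assms by (intro integrable_lebesgue_on_compact continuous_intros)
qed

lemma integral_norm_add_sq_le:
  assumes "L2_fun M f" "L2_fun M g" "0 < \<epsilon>"
  shows "integral\<^sup>L M (\<lambda>x. (norm (f x + g x))\<^sup>2)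
    \<le> (1 + \<epsilon>) * integral\<^sup>L M (\<lambda>x. (norm (f x))\<^sup>2) + (1 + 1 / \<epsilon>) * integral\<^sup>L M (\<lambda>x. (norm (g x))\<^sup>2)"
proof -
  note i = assms(1,2)[THEN L2_fun_integrable]
  have "integral\<^sup>L M (\<lambda>x. (norm (f x + g x))\<^sup>2)
      \<le> integral\<^sup>L M (\<lambda>x. (1 + \<epsilon>) * (norm (f x))\<^sup>2 + (1 + 1 / \<epsilon>) * (norm (g x))\<^sup>2)"
    using i L2_fun_integrable[OF L2_fun_add[OF assms(1,2)]] norm_add_sq_le[OF assms(3)]
    by (intro integral_mono) auto
  also have "\<dots> = (1 + \<epsilon>) * integral\<^sup>L M (\<lambda>x. (norm (f x))\<^sup>2) + (1 + 1 / \<epsilon>) * integral\<^sup>L M (\<lambda>x. (norm (g x))\<^sup>2)"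
    using i by simp
  finally show ?thesis .
qed

lemma integral_norm_diff_sq_le:
  assumes "L2_fun M f" "L2_fun M g" "L2_fun M k"
  shows "integral\<^sup>L M (\<lambda>x. (norm (f x - g x))\<^sup>2)
    \<le> 2 * integral\<^sup>L M (\<lambda>x. (norm (f x - k x))\<^sup>2) + 2 * integral\<^sup>L M (\<lambda>x. (norm (g x - k x))\<^sup>2)"
  using integral_norm_add_sq_le[of M "\<lambda>x. f x - k x" "\<lambda>x. k x - g x" 1] assms
  by (simp add: L2_fun_diff norm_minus_commute)

lemma tendsto_zero_sq_le:
  fixes f g :: "nat \<Rightarrow> real"
  assumes "g \<longlonglongrightarrow> 0" "\<And>n. (f n)\<^sup>2 \<le> g n"
  shows "f \<longlonglongrightarrow> 0"
proof -
  have "(\<lambda>n. (f n)\<^sup>2) \<longlonglongrightarrow> 0"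
    using assms by (intro tendsto_sandwich[OF _ _ tendsto_const assms(1)]) auto
  then show ?thesis by simp
qed

lemma finite_measure_unit: "finite_measure (lebesgue_on {0..1::real})"
  by (rule finite_measure_lebesgue_on) simp

text \<open>Each trace comes with its own approximating sequence. Two sequences with the same limit
  in the H1 norm have differences tending to zero there, and \<open>C\<close> carries this over to
  the edge means, so any such sequence \<open>w\<close> finds the mean of the trace.\<close>

lemma trace_mean_tendsto:
  assumes K: "compact K" and u: "L2_fun (lebesgue_on K) u" and g: "L2_fun (lebesgue_on K) g"
    and tr: "is_trace K u g A B tr"
    and C: "\<And>v G. C1_grad v G \<Longrightarrow> (unit_int (\<lambda>t. v (seg_param A B t)))\<^sup>2
        \<le> C * integral\<^sup>L (lebesgue_on K) (\<lambda>x. (v x)\<^sup>2 + (norm (G x))\<^sup>2)"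
    and w: "\<And>n. C1_grad (w n) (W n)"
    and wu: "(\<lambda>n. integral\<^sup>L (lebesgue_on K) (\<lambda>x. (w n x - u x)\<^sup>2)) \<longlonglongrightarrow> 0"
    and Wg: "(\<lambda>n. integral\<^sup>L (lebesgue_on K) (\<lambda>x. (norm (W n x - g x))\<^sup>2)) \<longlonglongrightarrow> 0"
  shows "(\<lambda>n. unit_int (\<lambda>t. w n (seg_param A B t))) \<longlonglongrightarrow> unit_int tr"
proof -
  obtain v G where v: "\<And>n. C1_grad (v n) (G n)"
    and vu: "(\<lambda>n. integral\<^sup>L (lebesgue_on K) (\<lambda>x. (v n x - u x)\<^sup>2)) \<longlonglongrightarrow> 0"
    and Gg: "(\<lambda>n. integral\<^sup>L (lebesgue_on K) (\<lambda>x. (norm (G n x - g x))\<^sup>2)) \<longlonglongrightarrow> 0"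
    and vt: "(\<lambda>n. unit_int (\<lambda>t. (v n (seg_param A B t) - tr t)\<^sup>2)) \<longlonglongrightarrow> 0"
    using tr unfolding is_trace_def by blast
  have t: "L2_fun (lebesgue_on {0..1}) tr"
    using tr unfolding is_trace_def L2_fun_def by simp
  have seg: "continuous_on {0..1} (\<lambda>t. f (seg_param A B t))" if "C1_grad f F" for f F
    by (rule continuous_on_compose2[OF C1_grad_continuous(1)[OF that, of UNIV]]) (auto intro: continuous_intros)
  have i: "integrable (lebesgue_on {0..1}) (\<lambda>t. f (seg_param A B t))" if "C1_grad f F" for f F
    by (intro integrable_unit seg[OF that])
  have "(\<lambda>n. unit_int (\<lambda>t. v n (seg_param A B t)) - unit_int tr) \<longlonglongrightarrow> 0"
  proof (rule tendsto_zero_sq_le[OF vt])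
    fix n
    have l: "L2_fun (lebesgue_on {0..1}) (\<lambda>t. v n (seg_param A B t) - tr t)"
      by (intro L2_fun_diff t L2_fun_continuous seg[OF v]) simp
    have "unit_int (\<lambda>t. v n (seg_param A B t)) - unit_int tr = unit_int (\<lambda>t. v n (seg_param A B t) - tr t)"
      using i[OF v] L2_fun_integrable_real(1)[OF t finite_measure_unit] by simp
    also have "\<dots>\<^sup>2 \<le> unit_int (\<lambda>t. (v n (seg_param A B t) - tr t)\<^sup>2)"
      by (intro sq_integral_le finite_measure_unit L2_fun_integrable_real[OF l]) simp
    finally show "(unit_int (\<lambda>t. v n (seg_param A B t)) - unit_int tr)\<^sup>2 \<le> unit_int (\<lambda>t. (v n (seg_param A B t) - tr t)\<^sup>2)" .
  qed
  moreover have "(\<lambda>n. unit_int (\<lambda>t. w n (seg_param A B t)) - unit_int (\<lambda>t. v n (seg_param A B t))) \<longlonglongrightarrow> 0"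
  proof (rule tendsto_zero_sq_le)
    let ?I = "\<lambda>f. integral\<^sup>L (lebesgue_on K) (\<lambda>x. f x :: real)"
    let ?J = "\<lambda>n. \<bar>C\<bar> * (2 * ?I (\<lambda>x. (w n x - u x)\<^sup>2) + 2 * ?I (\<lambda>x. (v n x - u x)\<^sup>2)
        + (2 * ?I (\<lambda>x. (norm (W n x - g x))\<^sup>2) + 2 * ?I (\<lambda>x. (norm (G n x - g x))\<^sup>2)))"
    have "?J \<longlonglongrightarrow> \<bar>C\<bar> * (2 * 0 + 2 * 0 + (2 * 0 + 2 * 0))"
      by (intro tendsto_intros wu vu Wg Gg)
    then show "?J \<longlonglongrightarrow> 0" by simp
    fix n
    note cont = C1_grad_continuous[OF v[of n]] C1_grad_continuous[OF w[of n]]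
    have l: "L2_fun (lebesgue_on K) (w n)" "L2_fun (lebesgue_on K) (v n)"
        "L2_fun (lebesgue_on K) (W n)" "L2_fun (lebesgue_on K) (G n)"
      by (intro L2_fun_continuous K cont)+
    have "(unit_int (\<lambda>t. w n (seg_param A B t)) - unit_int (\<lambda>t. v n (seg_param A B t)))\<^sup>2
        = (unit_int (\<lambda>t. w n (seg_param A B t) - v n (seg_param A B t)))\<^sup>2"
      using i[OF v] i[OF w] by simp
    also have "\<dots> \<le> C * ?I (\<lambda>x. (w n x - v n x)\<^sup>2 + (norm (W n x - G n x))\<^sup>2)"
      by (rule C[OF C1_grad_diff[OF w v]])
    also have "\<dots> \<le> \<bar>C\<bar> * ?I (\<lambda>x. (w n x - v n x)\<^sup>2 + (norm (W n x - G n x))\<^sup>2)"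
      by (intro mult_right_mono) auto
    also have "?I (\<lambda>x. (w n x - v n x)\<^sup>2 + (norm (W n x - G n x))\<^sup>2)
        = ?I (\<lambda>x. (norm (w n x - v n x))\<^sup>2) + ?I (\<lambda>x. (norm (W n x - G n x))\<^sup>2)"
      using L2_fun_integrable[OF L2_fun_diff[OF l(1,2)]] L2_fun_integrable[OF L2_fun_diff[OF l(3,4)]] by simp
    also have "\<bar>C\<bar> * \<dots> \<le> ?J n"
      using integral_norm_diff_sq_le[OF l(1,2) u] integral_norm_diff_sq_le[OF l(3,4) g]
      by (intro mult_left_mono add_mono) auto
    finally show "(unit_int (\<lambda>t. w n (seg_param A B t)) - unit_int (\<lambda>t. v n (seg_param A B t)))\<^sup>2 \<le> ?J n" .
  qed
  ultimately have "(\<lambda>n. (unit_int (\<lambda>t. w n (seg_param A B t)) - unit_int (\<lambda>t. v n (seg_param A B t)))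
      + (unit_int (\<lambda>t. v n (seg_param A B t)) - unit_int tr)) \<longlonglongrightarrow> 0 + 0"
    by (intro tendsto_add)
  then show ?thesis
    by (simp add: LIM_zero_iff)
qed

text \<open>The midpoint rule is exact for affine functions.\<close>

lemma unit_int_affine_seg_param: "unit_int (\<lambda>t. a + b \<bullet> seg_param A B t) = a + (b \<bullet> A + b \<bullet> B) / 2"
proof -
  have "unit_int (\<lambda>t. a + b \<bullet> seg_param A B t) = unit_int (\<lambda>t. (a + b \<bullet> A) + (b \<bullet> (B - A)) * t)"
    by (simp add: seg_param_def inner_add_right algebra_simps)
  also have "\<dots> = a + b \<bullet> A + (b \<bullet> (B - A)) / 2"
    using integrable_unit[of "\<lambda>t. t"] by (simp add: unit_int_ident continuous_intros)
  finally show ?thesis by (simp add: inner_diff_right field_simps)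
qed

lemma measure_triangle:
  assumes "\<not> collinear {P1, P2, P3}"
  shows "2 * measure lebesgue (convex hull {P1, P2, P3}) = tri_det P1 P2 P3"
proof -
  let ?K = "convex hull {P1, P2, P3}"
  have m: "?K \<in> sets lebesgue"
    by (rule fmeasurableD[OF lmeasurable_compact[OF compact_triangle]])
  have "integral\<^sup>L (lebesgue_on ?K) (\<lambda>_. 1 :: real) = tri_det P1 P2 P3 * ref_int (\<lambda>_. 1)"
    by (rule integral_tri_map[OF assms refl])
      (rule integrable_lebesgue_on_compact[OF compact_triangle continuous_on_const])
  then show ?thesis using m by (simp add: measure_restrict_space)
qed

theorem theorem3p3:
  fixes P1 P2 P3 :: "real^2"
    and u :: "real^2 \<Rightarrow> real" and g :: "real^2 \<Rightarrow> real^2"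
    and tr1 tr2 tr3 :: "real \<Rightarrow> real"
    and a :: real and b :: "real^2"
    and K :: "(real^2) set"
  assumes tri: "\<not> collinear {P1, P2, P3}"
    and K_def: "K = convex hull {P1, P2, P3}"
    and H1: "H1_on K u g"
    and tr1: "is_trace K u g P1 P2 tr1"
    and tr2: "is_trace K u g P2 P3 tr2"
    and tr3: "is_trace K u g P3 P1 tr3"
    and CR1: "edge_int P1 P2 (\<lambda>t. a + b \<bullet> seg_param P1 P2 t) = edge_int P1 P2 tr1"
    and CR2: "edge_int P2 P3 (\<lambda>t. a + b \<bullet> seg_param P2 P3 t) = edge_int P2 P3 tr2"
    and CR3: "edge_int P3 P1 (\<lambda>t. a + b \<bullet> seg_param P3 P1 t) = edge_int P3 P1 tr3"
  shows "sqrt (edge_int P1 P2 (\<lambda>t. (tr1 t - (a + b \<bullet> seg_param P1 P2 t))\<^sup>2))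
     \<le> 0.6711 * (Max {dist P1 P2, dist P2 P3, dist P3 P1}
                   / sqrt (2 * measure lebesgue K / dist P1 P2))
         * sqrt (integral\<^sup>L (lebesgue_on K) (\<lambda>x. (norm (g x - b))\<^sup>2))"
proof -
  define h where "h = Max {dist P1 P2, dist P2 P3, dist P3 P1}"
  have h: "dist P1 P2 \<le> h" "dist P2 P3 \<le> h" "dist P3 P1 \<le> h"
    by (auto simp: h_def)
  define d where "d = tri_det P1 P2 P3"
  have d: "0 < d" unfolding d_def by (rule tri_det_pos[OF tri])
  have ne: "P1 \<noteq> P2" "P2 \<noteq> P3" "P3 \<noteq> P1"
    using tri by (auto simp: insert_commute)
  have cK: "compact K" unfolding K_def by (rule compact_triangle)
  have u: "L2_fun (lebesgue_on K) u" and g: "L2_fun (lebesgue_on K) g"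
    using H1 by (auto simp: H1_on_def L2_on_def L2v_on_def L2_fun_def)
  obtain v G where v: "\<And>n. C1_grad (v n) (G n)"
    and vu: "(\<lambda>n. integral\<^sup>L (lebesgue_on K) (\<lambda>x. (v n x - u x)\<^sup>2)) \<longlonglongrightarrow> 0"
    and Gg: "(\<lambda>n. integral\<^sup>L (lebesgue_on K) (\<lambda>x. (norm (G n x - g x))\<^sup>2)) \<longlonglongrightarrow> 0"
    and vt: "(\<lambda>n. unit_int (\<lambda>t. (v n (seg_param P1 P2 t) - tr1 t)\<^sup>2)) \<longlonglongrightarrow> 0"
    using tr1 unfolding is_trace_def by blast
  have t1: "L2_fun (lebesgue_on {0..1}) tr1"
    using tr1 unfolding is_trace_def L2_fun_def by simp

  obtain C where C:
    "\<And>v G. C1_grad v G \<Longrightarrow> (unit_int (\<lambda>t. v (seg_param P1 P2 t)))\<^sup>2 \<le> C * integral\<^sup>L (lebesgue_on K) (\<lambda>x. (v x)\<^sup>2 + (norm (G x))\<^sup>2)"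
    "\<And>v G. C1_grad v G \<Longrightarrow> (unit_int (\<lambda>t. v (seg_param P2 P3 t)))\<^sup>2 \<le> C * integral\<^sup>L (lebesgue_on K) (\<lambda>x. (v x)\<^sup>2 + (norm (G x))\<^sup>2)"
    "\<And>v G. C1_grad v G \<Longrightarrow> (unit_int (\<lambda>t. v (seg_param P3 P1 t)))\<^sup>2 \<le> C * integral\<^sup>L (lebesgue_on K) (\<lambda>x. (v x)\<^sup>2 + (norm (G x))\<^sup>2)"
    using edge_means_bound_C1[OF tri K_def] by blast
  \<comment> \<open>Mean and slope along \<open>P1 P2\<close> of the interpolant of
    \<open>v n\<close>. Its means on the other two edges are taken along the sequence that belongs
    to \<open>tr1\<close>.\<close>
  define m s where "m n = unit_int (\<lambda>t. v n (seg_param P1 P2 t))"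
    and "s n = 2 * (unit_int (\<lambda>t. v n (seg_param P2 P3 t)) - unit_int (\<lambda>t. v n (seg_param P3 P1 t)))" for n
  have CR: "unit_int tr1 = a + (b \<bullet> P1 + b \<bullet> P2) / 2" "unit_int tr2 = a + (b \<bullet> P2 + b \<bullet> P3) / 2"
      "unit_int tr3 = a + (b \<bullet> P3 + b \<bullet> P1) / 2"
    using CR1 CR2 CR3 ne by (auto simp: edge_int_def unit_int_affine_seg_param)
  have m: "m \<longlonglongrightarrow> a + (b \<bullet> P1 + b \<bullet> P2) / 2"
    unfolding m_def CR(1)[symmetric] by (rule trace_mean_tendsto[OF cK u g tr1 C(1) v vu Gg])
  have "s \<longlonglongrightarrow> 2 * (unit_int tr2 - unit_int tr3)"
    unfolding s_def
    by (intro tendsto_intros trace_mean_tendsto[OF cK u g tr2 C(2) v vu Gg]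
        trace_mean_tendsto[OF cK u g tr3 C(3) v vu Gg])
  moreover have "2 * (unit_int tr2 - unit_int tr3) = b \<bullet> (P2 - P1)"
    by (simp add: CR inner_diff_right field_simps)
  ultimately have s: "s \<longlonglongrightarrow> b \<bullet> (P2 - P1)" by simp

  define X where "X = unit_int (\<lambda>t. (tr1 t - (a + b \<bullet> seg_param P1 P2 t))\<^sup>2)"
  define Y where "Y = integral\<^sup>L (lebesgue_on K) (\<lambda>x. (norm (g x - b))\<^sup>2)"
  define c where "c = 4/9 * h\<^sup>2 / d"
  have c0: "0 \<le> c" using d by (simp add: c_def)
  \<comment> \<open>Young's inequality is used twice, for the trace and for the gradient, so the
    constant becomes \<open>4/9 * (201/200)^2 = 40401/90000\<close>, still below
    \<open>0.6711^2\<close>.\<close>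
  define \<epsilon> :: real where "\<epsilon> = 1/200"
  have \<epsilon>: "0 < \<epsilon>" by (simp add: \<epsilon>_def)
  \<comment> \<open>Value at the midpoint of \<open>P1 P2\<close> and slope there of the interpolant
    of \<open>u\<close>; these are the limits of \<open>m\<close> and \<open>s\<close>.\<close>
  define \<mu> \<sigma> where "\<mu> = a + (b \<bullet> P1 + b \<bullet> P2) / 2" and "\<sigma> = b \<bullet> (P2 - P1)"
  have line: "a + b \<bullet> seg_param P1 P2 t = \<mu> + \<sigma> * (t - 1/2)" for t
    by (simp add: \<mu>_def \<sigma>_def seg_param_def inner_add_right inner_diff_right field_simps)
  define \<eta> where "\<eta> n = 2 * unit_int (\<lambda>t. (v n (seg_param P1 P2 t) - tr1 t)\<^sup>2)
     + 2 * (2 * (m n - \<mu>)\<^sup>2 + 2 * (s n - \<sigma>)\<^sup>2)" for n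
  define \<zeta> where "\<zeta> n = integral\<^sup>L (lebesgue_on K) (\<lambda>x. (norm (G n x - g x))\<^sup>2)" for n
  \<comment> \<open>The trace error is the interpolation error of \<open>v n\<close> plus terms
    collected in \<open>\<eta> n\<close>. The former is bounded by \<open>G n - b\<close>, which is
    \<open>g - b\<close> plus a difference measured by \<open>\<zeta> n\<close>.\<close>
  have step: "X \<le> (1 + \<epsilon>) * (c * ((1 + \<epsilon>) * Y + (1 + 1 / \<epsilon>) * \<zeta> n)) + (1 + 1 / \<epsilon>) * \<eta> n" for n
  proof -
    let ?v = "\<lambda>t. v n (seg_param P1 P2 t)" and ?l = "\<lambda>t. m n + s n * (t - 1/2)"
      and ?k = "\<lambda>t. \<mu> + \<sigma> * (t - 1/2)"
    have "continuous_on {0..1} ?v"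
      by (rule continuous_on_compose2[OF C1_grad_continuous(1)[OF v, of UNIV]]) (auto intro: continuous_intros)
    then have L: "L2_fun (lebesgue_on {0..1}) ?v" "L2_fun (lebesgue_on {0..1}) ?l" "L2_fun (lebesgue_on {0..1}) ?k"
      by (intro L2_fun_continuous continuous_intros; simp)+
    have G: "L2_fun (lebesgue_on K) (G n)" "L2_fun (lebesgue_on K) (\<lambda>_. b)"
      by (intro L2_fun_continuous cK C1_grad_continuous[OF v] continuous_intros)+
    have 1: "X \<le> (1 + \<epsilon>) * unit_int (\<lambda>t. (?v t - ?l t)\<^sup>2) + (1 + 1 / \<epsilon>) * unit_int (\<lambda>t. ((tr1 t - ?v t) + (?l t - ?k t))\<^sup>2)"
      using integral_norm_add_sq_le[OF L2_fun_diff[OF L(1,2)] L2_fun_add[OF L2_fun_diff[OF t1 L(1)] L2_fun_diff[OF L(2,3)]] \<epsilon>]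
      unfolding X_def line by (simp add: algebra_simps)
    have 2: "unit_int (\<lambda>t. ((tr1 t - ?v t) + (?l t - ?k t))\<^sup>2)
        \<le> 2 * unit_int (\<lambda>t. (?v t - tr1 t)\<^sup>2) + 2 * unit_int (\<lambda>t. (?l t - ?k t)\<^sup>2)"
      using integral_norm_add_sq_le[OF L2_fun_diff[OF t1 L(1)] L2_fun_diff[OF L(2,3)], of 1]
      by (simp add: power2_commute[of "tr1 _"])
    have 3: "unit_int (\<lambda>t. (?l t - ?k t)\<^sup>2) \<le> unit_int (\<lambda>_. 2 * (m n - \<mu>)\<^sup>2 + 2 * (s n - \<sigma>)\<^sup>2)"
    proof (intro integral_mono integrable_unit continuous_intros)
      fix t :: real assume "t \<in> space (lebesgue_on {0..1})"
      then have "\<bar>t - 1/2\<bar> \<le> 1" by auto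
      then have "(t - 1/2)\<^sup>2 \<le> 1" by (simp add: abs_square_le_1)
      then have "((s n - \<sigma>) * (t - 1/2))\<^sup>2 \<le> (s n - \<sigma>)\<^sup>2"
        unfolding power_mult_distrib by (simp add: mult_left_le)
      moreover have eq: "?l t - ?k t = (m n - \<mu>) + (s n - \<sigma>) * (t - 1/2)"
        by (simp add: left_diff_distrib)
      have "(?l t - ?k t)\<^sup>2 \<le> 2 * (m n - \<mu>)\<^sup>2 + 2 * ((s n - \<sigma>) * (t - 1/2))\<^sup>2"
        unfolding eq using norm_add_sq_le[of 1 "m n - \<mu>" "(s n - \<sigma>) * (t - 1/2)"] by simp
      ultimately show "(?l t - ?k t)\<^sup>2 \<le> 2 * (m n - \<mu>)\<^sup>2 + 2 * (s n - \<sigma>)\<^sup>2" by linarith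
    qed
    have "unit_int (\<lambda>t. ((tr1 t - ?v t) + (?l t - ?k t))\<^sup>2) \<le> \<eta> n"
      unfolding \<eta>_def
      by (intro order_trans[OF 2] add_left_mono mult_left_mono) (use 3[unfolded unit_int_const] in auto)
    then have "(1 + 1 / \<epsilon>) * unit_int (\<lambda>t. ((tr1 t - ?v t) + (?l t - ?k t))\<^sup>2) \<le> (1 + 1 / \<epsilon>) * \<eta> n"
      using \<epsilon> by (intro mult_left_mono) auto
    moreover have "(1 + \<epsilon>) * unit_int (\<lambda>t. (?v t - ?l t)\<^sup>2) \<le> (1 + \<epsilon>) * (c * ((1 + \<epsilon>) * Y + (1 + 1 / \<epsilon>) * \<zeta> n))"
    proof (intro mult_left_mono)
      have "unit_int (\<lambda>t. (?v t - ?l t)\<^sup>2) \<le> c * integral\<^sup>L (lebesgue_on K) (\<lambda>x. (norm (G n x - b))\<^sup>2)"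
        using edge_trace_bound_C1[OF tri K_def h v] unfolding m_def s_def c_def d_def .
      also have "\<dots> \<le> c * ((1 + \<epsilon>) * Y + (1 + 1 / \<epsilon>) * \<zeta> n)"
        using integral_norm_add_sq_le[OF L2_fun_diff[OF g G(2)] L2_fun_diff[OF G(1) g] \<epsilon>] c0
        unfolding Y_def \<zeta>_def by (intro mult_left_mono) auto
      finally show "unit_int (\<lambda>t. (?v t - ?l t)\<^sup>2) \<le> c * ((1 + \<epsilon>) * Y + (1 + 1 / \<epsilon>) * \<zeta> n)" .
    qed (use \<epsilon> in simp)
    ultimately show ?thesis using 1 by linarith
  qed
  have "\<eta> \<longlonglongrightarrow> 2 * 0 + 2 * (2 * (\<mu> - \<mu>)\<^sup>2 + 2 * (\<sigma> - \<sigma>)\<^sup>2)"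
    unfolding \<eta>_def by (intro tendsto_intros vt m[folded \<mu>_def] s[folded \<sigma>_def])
  then have \<eta>: "\<eta> \<longlonglongrightarrow> 0" by simp
  have "(\<lambda>n. (1 + \<epsilon>) * (c * ((1 + \<epsilon>) * Y + (1 + 1 / \<epsilon>) * \<zeta> n)) + (1 + 1 / \<epsilon>) * \<eta> n)
      \<longlonglongrightarrow> (1 + \<epsilon>) * (c * ((1 + \<epsilon>) * Y + (1 + 1 / \<epsilon>) * 0)) + (1 + 1 / \<epsilon>) * 0"
    by (intro tendsto_intros \<eta> Gg[folded \<zeta>_def])
  then have "X \<le> (1 + \<epsilon>) * (c * ((1 + \<epsilon>) * Y + (1 + 1 / \<epsilon>) * 0)) + (1 + 1 / \<epsilon>) * 0"
    by (rule LIMSEQ_le_const) (use step in blast)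
  also have "\<dots> = (40401/90000) * (h\<^sup>2 / d * Y)"
    by (simp add: \<epsilon>_def c_def field_simps)
  also have "\<dots> \<le> (0.6711)\<^sup>2 * (h\<^sup>2 / d * Y)"
  proof (rule mult_right_mono)
    show "(40401/90000 :: real) \<le> (0.6711)\<^sup>2" by (simp add: power2_eq_square)
    show "0 \<le> h\<^sup>2 / d * Y" using d by (simp add: Y_def)
  qed
  finally have X: "X \<le> (0.6711)\<^sup>2 * (h\<^sup>2 / d * Y)" .
  define e where "e = dist P1 P2"
  have e: "0 < e" using ne by (simp add: e_def)
  have h0: "0 \<le> h" using h(1) zero_le_dist order_trans by blast
  \<comment> \<open>The edge length \<open>e\<close> from \<open>edge_int\<close> combines with
    \<open>d\<close>, twice the area, to the height \<open>d / e\<close> over the edge.\<close>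
  have "sqrt (e * X) \<le> sqrt ((0.6711)\<^sup>2 * (h\<^sup>2 / (d / e) * Y))"
    using mult_left_mono[OF X, of e] e by (simp add: field_simps)
  also have "\<dots> = 0.6711 * (h / sqrt (d / e)) * sqrt Y"
    using h0 by (simp add: real_sqrt_mult real_sqrt_divide)
  finally show ?thesis
    unfolding edge_int_def X_def Y_def e_def d_def h_def K_def measure_triangle[OF tri] .
qed

end
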